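(* Let $1\le s\le 4$ be an integer. Then $\widehat{R}_{s/s,2}=2s$. Moreover, the unique function $\psi\in\widehat{\Pi}_{s/s,2}$ with $R(\psi)=2s$ is \[ \psi(z)=\frac{\left(1+\frac{z}{2s}\right)^s}{\left(1-\frac{z}{2s}\right)^s}. \]
   Context: A real rational function $\psi$ is always considered in lowest terms, as a smooth function on $\mathbb{R}$ minus its finitely many poles. It is absolutely monotonic at $x\in\mathbb{R}$ if $x$ is not a pole and $\psi^{(k)}(x)\ge 0$ for all integers $k\ge 0$. The radius of absolute monotonicity is $R(\psi)=\sup\big(\{r\in[0,\infty): \psi \text{ is absolutely monotonic at each point of } [-r,0]\}\cup\{0\}\big)\in[0,+\infty]$. For $m,n,p\in\mathbb{N}$, $\Pi_{m/n,p}$ denotes the set of rational functions $\psi=P/Q$ with $P,Q$ real polynomials, $\deg P\le m$, $Q\not\equiv 0$, $\deg Q\le n$, such that $\psi(z)-e^z=O(z^{p+1})$ as $z\to 0$. The set $\widehat{\Pi}_{m/n,p}$ consists of those $\psi\in\Pi_{m/n,p}$ that can be written as $\psi(z)=P(z)/(1-az)^n$ with $\deg P\le m$ and $a\in\mathbb{R}$. Finally, $\widehat{R}_{m/n,p}=\sup\{R(\psi):\psi\in\widehat{\Pi}_{m/n,p}\}$. *)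

theory Defs
  imports "HOL-Analysis.Analysis" "HOL-Computational_Algebra.Computational_Algebra" "HOL-Computational_Algebra.Field_as_Ring"
    "HOL-Library.Landau_Symbols" "HOL-Library.Extended_Real"
begin

text \<open>A real rational function is represented by a pair of real polynomials (P, Q), Q nonzero,
  standing for P/Q. Its lowest-terms form is (P div gcd P Q, Q div gcd P Q).\<close>

definition rnum :: "real poly \<Rightarrow> real poly \<Rightarrow> real poly" where
  "rnum P Q = P div gcd P Q"

definition rden :: "real poly \<Rightarrow> real poly \<Rightarrow> real poly" where
  "rden P Q = Q div gcd P Q"

definition rfun :: "real poly \<Rightarrow> real poly \<Rightarrow> real \<Rightarrow> real" where
  "rfun P Q = (\<lambda>t. poly (rnum P Q) t / poly (rden P Q) t)"

definition is_pole :: "real poly \<Rightarrow> real poly \<Rightarrow> real \<Rightarrow> bool" where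
  "is_pole P Q x \<longleftrightarrow> poly (rden P Q) x = 0"

definition abs_monotonic_at :: "real poly \<Rightarrow> real poly \<Rightarrow> real \<Rightarrow> bool" where
  "abs_monotonic_at P Q x \<longleftrightarrow>
     \<not> is_pole P Q x \<and> (\<forall>k::nat. (deriv ^^ k) (rfun P Q) x \<ge> 0)"

definition radius_am :: "real poly \<Rightarrow> real poly \<Rightarrow> ereal" where
  "radius_am P Q = Sup (ereal ` ({r. r \<ge> 0 \<and> (\<forall>x\<in>{-r..0}. abs_monotonic_at P Q x)} \<union> {0}))"

definition in_Pi :: "nat \<Rightarrow> nat \<Rightarrow> nat \<Rightarrow> real poly \<Rightarrow> real poly \<Rightarrow> bool" where
  "in_Pi m n p P Q \<longleftrightarrow> degree P \<le> m \<and> Q \<noteq> 0 \<and> degree Q \<le> n \<and>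
     (\<lambda>z. poly P z / poly Q z - exp z) \<in> O[at 0](\<lambda>z. z ^ (p + 1))"

definition in_hatPi :: "nat \<Rightarrow> nat \<Rightarrow> nat \<Rightarrow> real poly \<Rightarrow> real \<Rightarrow> bool" where
  "in_hatPi m n p P a \<longleftrightarrow> in_Pi m n p P ([:1, -a:] ^ n)"

definition hatR :: "nat \<Rightarrow> nat \<Rightarrow> nat \<Rightarrow> ereal" where
  "hatR m n p = Sup {radius_am P ([:1, -a:] ^ n) | P a. in_hatPi m n p P a}"

end

theory Submission
  imports Defs "HOL-Real_Asymp.Real_Asymp"
begin

text \<open>
  For \<open>a > 0\<close> write \<open>\<psi>(z) = \<Sum>\<^sub>j c\<^sub>j w\<^sup>j\<close> with \<open>w = 1 / (1 - a z)\<close>, and let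
  \<open>\<gamma>\<^sub>k = (2s)\<^sup>k \<psi>\<^sup>(\<^sup>k\<^sup>)(-2s) / k!\<close>. By the order conditions the \<open>\<gamma>\<^sub>k\<close> have total mass 1, mean \<open>2s\<close> and variance
  \<open>2s\<close>; moreover \<open>\<gamma>\<^sub>k = \<rho>\<^sup>k q(k - 1)\<close> for \<open>k \<ge> 1\<close>, where \<open>\<rho> = y / (1 + y)\<close>, \<open>y = 2sa\<close> and \<open>q\<close> is a polynomial
  of degree less than \<open>s\<close>. If \<open>\<psi>\<close> is absolutely monotonic on \<open>(-2s, 0]\<close>, then \<open>\<gamma>\<^sub>0 \<ge> 0\<close> and \<open>q \<ge> 0\<close> on the natural
  numbers. In the Newton basis, \<open>q(m) = \<Sum>\<^sub>\<sigma> b\<^sub>\<sigma> (m choose (\<sigma> - 1))\<close>, the weight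
  \<open>b\<^sub>\<sigma> y\<^sup>\<sigma>\<close> multiplies the distribution of a sum of \<open>\<sigma>\<close> independent geometric variables with mean \<open>x = 1 + y\<close>.
  The moment conditions yield a linear functional vanishing on \<open>(\<gamma>\<^sub>k)\<close> that, by interpolating \<open>q\<close> at
  suitable pairs of consecutive integers, has positive weights: for \<open>y \<le> 1\<close> this leaves only the top coefficient
  \<open>b\<^sub>s\<close>, which is the claimed function with \<open>y = 1\<close>, and for \<open>y > 1\<close> it gives a contradiction.
  For \<open>a = 0\<close> the \<open>\<gamma>\<^sub>k\<close> vanish beyond \<open>k = s\<close>, so the mean is too small; for \<open>a < 0\<close> the Taylor coefficients
  at 0 are \<open>a\<^sup>k\<close> times a polynomial in \<open>k\<close> that has to alternate in sign, so its finite differences cannot vanish.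
\<close>

section \<open>Functionals positive on polynomials that are nonnegative on the naturals\<close>

lemma binomial_sum_eq_falling:
  fixes b :: "nat \<Rightarrow> real"
  shows "(\<Sum>\<sigma>\<in>{1..1}. b \<sigma> * real (m choose (\<sigma> - 1))) = b 1"
    and "(\<Sum>\<sigma>\<in>{1..2}. b \<sigma> * real (m choose (\<sigma> - 1))) = b 1 + b 2 * m"
    and "(\<Sum>\<sigma>\<in>{1..3}. b \<sigma> * real (m choose (\<sigma> - 1))) = b 1 + b 2 * m + b 3 * (m * (real m - 1) / 2)"
    and "(\<Sum>\<sigma>\<in>{1..4}. b \<sigma> * real (m choose (\<sigma> - 1))) =
      b 1 + b 2 * m + b 3 * (m * (real m - 1) / 2) + b 4 * (m * (real m - 1) * (real m - 2) / 6)"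
proof -
  have c2: "real (m choose 2) = m * (real m - 1) / 2"
    by (simp add: binomial_gbinomial gbinomial_prod_rev eval_nat_numeral atLeast0_lessThan_Suc)
  have c3: "real (m choose 3) = m * (real m - 1) * (real m - 2) / 6"
    by (simp add: binomial_gbinomial gbinomial_prod_rev eval_nat_numeral atLeast0_lessThan_Suc algebra_simps)
  have s: "{1..2} = {1,2::nat}" "{1..3} = {1,2,3::nat}" "{1..4} = {1,2,3,4::nat}" by auto
  show "(\<Sum>\<sigma>\<in>{1..1}. b \<sigma> * real (m choose (\<sigma> - 1))) = b 1" by simp
  show "(\<Sum>\<sigma>\<in>{1..2}. b \<sigma> * real (m choose (\<sigma> - 1))) = b 1 + b 2 * m"
    unfolding s by simp
  show "(\<Sum>\<sigma>\<in>{1..3}. b \<sigma> * real (m choose (\<sigma> - 1))) = b 1 + b 2 * m + b 3 * (m * (real m - 1) / 2)"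
    unfolding s by (simp add: c2)
  show "(\<Sum>\<sigma>\<in>{1..4}. b \<sigma> * real (m choose (\<sigma> - 1))) =
      b 1 + b 2 * m + b 3 * (m * (real m - 1) / 2) + b 4 * (m * (real m - 1) * (real m - 2) / 6)"
    unfolding s by (simp add: c2 c3)
qed

text \<open>The factor below is the mean of \<open>K\<^sup>2 - \<tau> K + 2s(s + 1)x\<close> over a sum \<open>K\<close> of \<open>\<sigma>\<close> geometric variables with
  mean \<open>x\<close>; the choice \<open>\<tau> = (s + 1) x + 2s + 1\<close> makes it vanish at \<open>\<sigma> = s\<close>.\<close>

lemma low_moment_identity:
  fixes b :: "nat \<Rightarrow> real" and x y :: real
  assumes N0: "(\<Sum>\<sigma>\<le>s. b \<sigma> * y ^ \<sigma>) = 1"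
    and N1: "x * (\<Sum>\<sigma>\<le>s. real \<sigma> * (b \<sigma> * y ^ \<sigma>)) = 2 * real s"
    and N2: "x\<^sup>2 * (\<Sum>\<sigma>\<le>s. real \<sigma> ^ 2 * (b \<sigma> * y ^ \<sigma>)) = 4 * real s ^ 2 - 2 * real s * (x - 2)"
  shows "(\<Sum>\<sigma>\<le>s. b \<sigma> * y ^ \<sigma> * (x * ((real s - \<sigma>) * (2 * (real s + 1) - \<sigma> * x)))) = 0"
proof -
  have "(\<Sum>\<sigma>\<le>s. b \<sigma> * y ^ \<sigma> * (x * ((real s - \<sigma>) * (2 * (real s + 1) - \<sigma> * x)))) =
     2 * real s * (real s + 1) * x * (\<Sum>\<sigma>\<le>s. b \<sigma> * y ^ \<sigma>)
     - (s * x + 2 * (real s + 1)) * (x * (\<Sum>\<sigma>\<le>s. real \<sigma> * (b \<sigma> * y ^ \<sigma>)))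
     + x\<^sup>2 * (\<Sum>\<sigma>\<le>s. real \<sigma> ^ 2 * (b \<sigma> * y ^ \<sigma>))"
    unfolding sum_distrib_left sum.distrib[symmetric] sum_subtractf[symmetric]
    by (intro sum.cong refl) (simp add: algebra_simps power2_eq_square)
  also have "\<dots> = 0"
    unfolding N0 N1 N2 by (simp add: algebra_simps power2_eq_square)
  finally show ?thesis .
qed

text \<open>A sum \<open>K\<close> of \<open>\<sigma>\<close> geometric variables with mean
  \<open>x\<close> has variance \<open>\<sigma> * x * (x - 1)\<close>, so the factor is the mean of
  \<open>(K - 2s)^2 - (x - 1) K + c (x - 2)\<close>. Total mean and variance \<open>2s\<close> turn
  this into the right-hand side, which is negative for \<open>x > 2\<close> and
  \<open>c < 2s\<close>.\<close>

lemma high_moment_identity: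
  fixes b :: "nat \<Rightarrow> real" and x y :: real
  assumes N0: "(\<Sum>\<sigma>\<le>s. b \<sigma> * y ^ \<sigma>) = 1"
    and N1: "x * (\<Sum>\<sigma>\<le>s. real \<sigma> * (b \<sigma> * y ^ \<sigma>)) = 2 * real s"
    and N2: "x\<^sup>2 * (\<Sum>\<sigma>\<le>s. real \<sigma> ^ 2 * (b \<sigma> * y ^ \<sigma>)) = 4 * real s ^ 2 - 2 * real s * (x - 2)"
  shows "(\<Sum>\<sigma>\<le>s. b \<sigma> * y ^ \<sigma> * ((\<sigma> * x - 2 * real s)\<^sup>2 + c * (x - 2))) = (c - 2 * real s) * (x - 2)"
proof -
  have "(\<Sum>\<sigma>\<le>s. b \<sigma> * y ^ \<sigma> * ((\<sigma> * x - 2 * real s)\<^sup>2 + c * (x - 2))) =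
     (4 * real s ^ 2 + c * (x - 2)) * (\<Sum>\<sigma>\<le>s. b \<sigma> * y ^ \<sigma>)
     - 4 * s * (x * (\<Sum>\<sigma>\<le>s. real \<sigma> * (b \<sigma> * y ^ \<sigma>)))
     + x\<^sup>2 * (\<Sum>\<sigma>\<le>s. real \<sigma> ^ 2 * (b \<sigma> * y ^ \<sigma>))"
    unfolding sum_distrib_left sum.distrib[symmetric] sum_subtractf[symmetric]
    by (intro sum.cong refl) (simp add: algebra_simps power2_eq_square)
  also have "\<dots> = (c - 2 * real s) * (x - 2)"
    unfolding N0 N1 N2 by (simp add: algebra_simps power2_eq_square)
  finally show ?thesis .
qed

section \<open>Nonnegative functionals on quadratic and cubic polynomials\<close>

lemma quadratic_form_nonneg:
  fixes A B C t :: real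
  assumes "A > 0" and "B\<^sup>2 \<le> 4 * A * C"
  shows "0 \<le> A * t\<^sup>2 + B * t + C"
proof -
  have "4 * A * (A * t\<^sup>2 + B * t + C) = (2 * A * t + B)\<^sup>2 + (4 * A * C - B\<^sup>2)"
    by (simp add: algebra_simps power2_eq_square)
  also have "\<dots> \<ge> 0" using assms by simp
  finally show ?thesis using assms(1) by (simp add: zero_le_mult_iff)
qed

lemma quadratic_leading_coeff_nonneg:
  fixes q0 q1 q2 :: real
  assumes "\<And>m::nat. 0 \<le> q0 + q1 * m + q2 * (m * (real m - 1) / 2)"
  shows "0 \<le> q2"
proof (rule ccontr)
  assume "\<not> 0 \<le> q2"
  have "filterlim (\<lambda>m::nat. q0 + q1 * m + q2 * (m * (real m - 1) / 2)) at_bot sequentially"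
    using \<open>\<not> 0 \<le> q2\<close> by real_asymp
  then have "eventually (\<lambda>m::nat. q0 + q1 * m + q2 * (m * (real m - 1) / 2) < 0) sequentially"
    by (simp add: filterlim_at_bot_dense)
  then show False
    using assms eventually_happens'[OF sequentially_bot] by (meson not_le)
qed

lemma cubic_leading_coeff_nonneg:
  fixes q0 q1 q2 q3 :: real
  assumes "\<And>m::nat. 0 \<le> q0 + q1 * m + q2 * (m * (real m - 1) / 2) + q3 * (m * (real m - 1) * (real m - 2) / 6)"
  shows "0 \<le> q3"
proof (rule ccontr)
  assume "\<not> 0 \<le> q3"
  have "filterlim (\<lambda>m::nat. q0 + q1 * m + q2 * (m * (real m - 1) / 2) + q3 * (m * (real m - 1) * (real m - 2) / 6)) at_bot sequentially"
    using \<open>\<not> 0 \<le> q3\<close> by real_asymp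
  then have "eventually (\<lambda>m::nat. q0 + q1 * m + q2 * (m * (real m - 1) / 2) + q3 * (m * (real m - 1) * (real m - 2) / 6) < 0) sequentially"
    by (simp add: filterlim_at_bot_dense)
  then show False
    using assms eventually_happens'[OF sequentially_bot] by (meson not_le)
qed

text \<open>Let \<open>L\<close> take the values \<open>S0\<close>, \<open>S1\<close>,
  \<open>S2\<close> on \<open>1\<close>, \<open>m\<close>, \<open>m (m - 1) / 2\<close>. The last
  hypothesis says \<open>L ((m - i) (m - i - 1)) \<ge> 0\<close>; such a product is nonnegative on
  integers, though not on reals. The node \<open>j\<close> is the floor of the mean
  \<open>L(m) / L(1)\<close>.\<close>

lemma quadratic_functional_nonneg:
  fixes S0 S1 S2 q0 q1 q2 :: real
  assumes q: "\<And>m::nat. 0 \<le> q0 + q1 * m + q2 * (m * (real m - 1) / 2)"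
    and "S0 > 0" "S1 \<ge> 0"
    and T: "\<And>i::nat. 0 \<le> 2 * S2 - 2 * i * S1 + real i * (real i + 1) * S0"
  shows "0 \<le> q0 * S0 + q1 * S1 + q2 * S2"
proof -
  \<comment> \<open>Interpolation at \<open>j\<close>, \<open>j + 1\<close> and infinity; the choice of \<open>j\<close> makes the first two weights nonnegative.\<close>
  define j where "j = nat \<lfloor>S1 / S0\<rfloor>"
  have j: "real j * S0 \<le> S1" "S1 \<le> (real j + 1) * S0"
  proof -
    have "real j = \<lfloor>S1 / S0\<rfloor>" using assms(2,3) by (simp add: j_def)
    then have "real j \<le> S1 / S0" "S1 / S0 \<le> real j + 1" by linarith+
    then show "real j * S0 \<le> S1" "S1 \<le> (real j + 1) * S0"
      using \<open>S0 > 0\<close> by (simp_all add: field_simps)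
  qed
  define Q where "Q = (\<lambda>m. q0 + q1 * m + q2 * (m * (m - 1) / 2))"
  define T where "T = 2 * S2 - 2 * real j * S1 + real j * (real j + 1) * S0"
  have "q0 * S0 + q1 * S1 + q2 * S2 = Q (real j) * ((real j + 1) * S0 - S1)
      + Q (real (Suc j)) * (S1 - real j * S0) + q2 / 2 * T"
    by (simp add: Q_def T_def field_simps)
  moreover have "0 \<le> Q (real j)" "0 \<le> Q (real (Suc j))" unfolding Q_def by (rule q)+
  moreover have "0 \<le> q2 / 2" using quadratic_leading_coeff_nonneg[of q0 q1 q2, OF q] by simp
  moreover have "0 \<le> T" using T[of j] by (simp add: T_def)
  ultimately show ?thesis using j by simp
qed

text \<open>With \<open>L\<close> as in the quadratic case and \<open>S3\<close> its value on
  \<open>m choose 3\<close>, the hypotheses say that \<open>L\<close> is nonnegative on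
  \<open>(m - i) (m - i - 1)\<close> and on \<open>m (m - i) (m - i - 1)\<close>. Since
  \<open>2 * S2 + S1\<close> is \<open>L(m^2)\<close>, the node \<open>j\<close> is the floor of
  \<open>L(m^2) / L(m)\<close>, the mean after weighting by \<open>m\<close>.\<close>

lemma cubic_functional_nonneg:
  fixes S0 S1 S2 S3 q0 q1 q2 q3 :: real
  assumes q: "\<And>m::nat. 0 \<le> q0 + q1 * m + q2 * (m * (real m - 1) / 2) + q3 * (m * (real m - 1) * (real m - 2) / 6)"
    and "S1 > 0" "S2 \<ge> 0"
    and T2: "\<And>i::nat. i \<ge> 1 \<Longrightarrow> 0 \<le> 2 * S2 - 2 * i * S1 + real i * (real i + 1) * S0"
    and T3: "\<And>i::nat. i \<ge> 1 \<Longrightarrow> 0 \<le> 6 * S3 - 4 * (real i - 1) * S2 + real i * (real i - 1) * S1"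
  shows "0 \<le> q0 * S0 + q1 * S1 + q2 * S2 + q3 * S3"
proof -
  \<comment> \<open>Interpolation at \<open>0\<close>, \<open>j\<close>, \<open>j + 1\<close> and infinity.\<close>
  define j where "j = nat \<lfloor>(2 * S2 + S1) / S1\<rfloor>"
  have j: "real j * S1 \<le> 2 * S2 + S1" "2 * S2 + S1 \<le> (real j + 1) * S1" "j \<ge> 1"
  proof -
    have ge1: "(2 * S2 + S1) / S1 \<ge> 1" using assms(2,3) by simp
    then have "\<lfloor>(2 * S2 + S1) / S1\<rfloor> \<ge> 1" by simp
    then have "real j = \<lfloor>(2 * S2 + S1) / S1\<rfloor>" and "j \<ge> 1" unfolding j_def by linarith+
    then have "real j \<le> (2 * S2 + S1) / S1" "(2 * S2 + S1) / S1 \<le> real j + 1" by linarith+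
    then show "real j * S1 \<le> 2 * S2 + S1" "2 * S2 + S1 \<le> (real j + 1) * S1"
      using \<open>S1 > 0\<close> by (simp_all add: field_simps)
    show "j \<ge> 1" by fact
  qed
  define Q where "Q = (\<lambda>m. q0 + q1 * m + q2 * (m * (m - 1) / 2) + q3 * (m * (m - 1) * (m - 2) / 6))"
  define U where "U = 2 * S2 - 2 * real j * S1 + real j * (real j + 1) * S0"
  define V where "V = 6 * S3 - 4 * (real j - 1) * S2 + real j * (real j - 1) * S1"
  have "real j * (real j + 1) * (q0 * S0 + q1 * S1 + q2 * S2 + q3 * S3) =
      Q 0 * U + (real j + 1) * (Q (real j) * ((real j + 1) * S1 - (2 * S2 + S1)))
      + real j * (Q (real (Suc j)) * (2 * S2 + S1 - real j * S1)) + real j * (real j + 1) * (q3 / 6 * V)"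
    by (simp add: Q_def U_def V_def field_simps)
  moreover have "0 \<le> Q 0" using q[of 0] by (simp add: Q_def)
  moreover have "0 \<le> Q (real j)" "0 \<le> Q (real (Suc j))" unfolding Q_def by (rule q)+
  moreover have "0 \<le> q3 / 6" using cubic_leading_coeff_nonneg[of q0 q1 q2 q3, OF q] by simp
  moreover have "0 \<le> U" "0 \<le> V" using T2[OF j(3)] T3[OF j(3)] by (simp_all add: U_def V_def)
  ultimately have "0 \<le> real j * (real j + 1) * (q0 * S0 + q1 * S1 + q2 * S2 + q3 * S3)"
    using j(1,2) by simp
  moreover have "real j * (real j + 1) > 0" using \<open>j \<ge> 1\<close> by simp
  ultimately show ?thesis by (metis mult_le_cancel_left_pos mult_zero_right)
qed

section \<open>Consequences of the moment conditions for \<open>y \<le> 1\<close> and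
  \<open>y > 1\<close>\<close>

lemma sum_atMost_up_to_4:
  fixes f :: "nat \<Rightarrow> real"
  shows "(\<Sum>i\<le>1. f i) = f 0 + f 1" "(\<Sum>i\<le>2. f i) = f 0 + f 1 + f 2"
    "(\<Sum>i\<le>3. f i) = f 0 + f 1 + f 2 + f 3" "(\<Sum>i\<le>4. f i) = f 0 + f 1 + f 2 + f 3 + f 4"
  by (simp_all add: eval_nat_numeral)

lemma nonneg_combination_eq_0:
  fixes u v :: real
  assumes "A * u + v = 0" "A > 0" "u \<ge> 0" "v \<ge> 0"
  shows "u = 0" and "v = 0"
proof -
  have "A * u \<ge> 0" using assms by simp
  then have "A * u = 0" "v = 0" using assms by linarith+
  then show "u = 0" "v = 0" using assms by auto
qed

text \<open>The factor \<open>s - \<sigma>\<close> removes the top coefficient. The remaining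
  \<open>b \<sigma>\<close> with \<open>\<sigma> \<ge> 1\<close> are finite differences of the
  values \<open>q(0), ..., q(s - 2)\<close>; in terms of \<open>b 0\<close> and these values all
  weights are positive for \<open>y \<le> 1\<close>, so every one of them vanishes.\<close>

lemma coeffs_vanish_below_top:
  fixes b :: "nat \<Rightarrow> real" and x y :: real
  assumes s: "1 \<le> s" "s \<le> 4" and y: "0 < y" "y \<le> 1" "x = 1 + y"
    and N0: "(\<Sum>\<sigma>\<le>s. b \<sigma> * y ^ \<sigma>) = 1"
    and N1: "x * (\<Sum>\<sigma>\<le>s. real \<sigma> * (b \<sigma> * y ^ \<sigma>)) = 2 * real s"
    and N2: "x\<^sup>2 * (\<Sum>\<sigma>\<le>s. real \<sigma> ^ 2 * (b \<sigma> * y ^ \<sigma>)) = 4 * real s ^ 2 - 2 * real s * (x - 2)"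
    and b0: "0 \<le> b 0" and q: "\<And>m::nat. 0 \<le> (\<Sum>\<sigma>\<in>{1..s}. b \<sigma> * real (m choose (\<sigma> - 1)))"
    and "\<sigma> < s"
  shows "b \<sigma> = 0"
proof -
  have low: "(\<Sum>\<sigma>\<le>s. b \<sigma> * y ^ \<sigma> * ((real s - \<sigma>) * (2 * (real s + 1) - \<sigma> * x))) = 0"
  proof -
    have "x * (\<Sum>\<sigma>\<le>s. b \<sigma> * y ^ \<sigma> * ((real s - \<sigma>) * (2 * (real s + 1) - \<sigma> * x))) = 0"
      using low_moment_identity[OF N0 N1 N2] by (simp add: sum_distrib_left mult_ac)
    then show ?thesis using y by simp
  qed
  from s consider "s = 1" | "s = 2" | "s = 3" | "s = 4" by linarith
  then show ?thesis
  proof cases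
    case 1
    have "b 0 * 4 = 0" using low unfolding 1 sum_atMost_up_to_4 by simp
    then show ?thesis using \<open>\<sigma> < s\<close> 1 by simp
  next
    case 2
    define q0 where "q0 = b 1"
    note q' = q[unfolded 2 binomial_sum_eq_falling]
    have "12 * b 0 + (y * (6 - x)) * q0 = 0"
      using low unfolding 2 sum_atMost_up_to_4 by (simp add: q0_def algebra_simps)
    moreover have "y * (6 - x) > 0" "q0 \<ge> 0" using y q'[of 0] by (simp_all add: q0_def)
    ultimately have "b 0 = 0" "q0 = 0" using b0 nonneg_combination_eq_0[of 12 "b 0" "(y * (6 - x)) * q0"] by auto
    then show ?thesis using \<open>\<sigma> < s\<close> 2 by (auto simp: q0_def less_Suc_eq numeral_eq_Suc)
  next
    case 3
    define q0 q1 where "q0 = b 1" and "q1 = b 1 + b 2"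
    note q' = q[unfolded 3 binomial_sum_eq_falling]
    have qs: "q0 \<ge> 0" "q1 \<ge> 0" using q'[of 0] q'[of 1] by (simp_all add: q0_def q1_def)
    define w0 w1 where "w0 = y * (2 * (7 - y) - y * (6 - 2 * y))" and "w1 = y\<^sup>2 * (6 - 2 * y)"
    have e: "24 * b 0 + (w0 * q0 + w1 * q1) = 0"
      using low unfolding 3 sum_atMost_up_to_4
      by (simp add: q0_def q1_def w0_def w1_def y(3) algebra_simps power2_eq_square)
    have w: "w0 > 0" "w1 > 0"
    proof -
      have "y * (6 - 2 * y) \<le> 1 * 6" using y by (intro mult_mono) auto
      then show "w0 > 0" using y unfolding w0_def by (intro mult_pos_pos) auto
      show "w1 > 0" using y unfolding w1_def by (intro mult_pos_pos) auto
    qed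
    have nn: "0 \<le> w0 * q0 + w1 * q1" "0 \<le> w1 * q1" using w qs by auto
    note r0 = nonneg_combination_eq_0[OF e _ b0 nn(1), simplified]
    note r1 = nonneg_combination_eq_0[OF r0(2) w(1) qs(1) nn(2)]
    have "q1 = 0" using r1(2) w by simp
    then have "b 0 = 0" "b 1 = 0" "b 2 = 0" using r0(1) r1(1) by (auto simp: q0_def q1_def)
    moreover have "\<sigma> = 0 \<or> \<sigma> = 1 \<or> \<sigma> = 2" using \<open>\<sigma> < s\<close> 3 by linarith
    ultimately show ?thesis by auto
  next
    case 4
    \<comment> \<open>These are \<open>q(0)\<close>, \<open>q(1)\<close>, \<open>q(2)\<close>, so
      \<open>b 2 = q1 - q0\<close> and \<open>b 3 = q2 - 2 * q1 + q0\<close>; the weights below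
      collect the terms of \<open>low\<close> accordingly.\<close>
    define q0 q1 q2 where "q0 = b 1" and "q1 = b 1 + b 2" and "q2 = b 1 + 2 * b 2 + b 3"
    define w0 w1 w2 where "w0 = y * (3 * (9 - y) - y * (4 * (4 - y)) + y\<^sup>2 * (7 - 3 * y))"
      and "w1 = y\<^sup>2 * (4 * (4 - y) - 2 * y * (7 - 3 * y))" and "w2 = y ^ 3 * (7 - 3 * y)"
    note q' = q[unfolded 4 binomial_sum_eq_falling]
    have qs: "q0 \<ge> 0" "q1 \<ge> 0" "q2 \<ge> 0"
      using q'[of 0] q'[of 1] q'[of 2] by (simp_all add: q0_def q1_def q2_def)
    have e: "40 * b 0 + (w0 * q0 + (w1 * q1 + w2 * q2)) = 0"
      using low unfolding 4 sum_atMost_up_to_4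
      by (simp add: q0_def q1_def q2_def w0_def w1_def w2_def y(3) algebra_simps power2_eq_square power3_eq_cube)
    have w: "w0 > 0" "w1 > 0" "w2 > 0"
    proof -
      have "y * (4 * (4 - y)) \<le> 1 * 16" using y by (intro mult_mono) auto
      moreover have "0 \<le> y\<^sup>2 * (7 - 3 * y)" using y by (intro mult_nonneg_nonneg) auto
      moreover have "3 * (9 - y) \<ge> 24" using y by simp
      moreover have "C - A + B > 0" if "A \<le> 1 * 16" "0 \<le> B" "C \<ge> 24" for A B C :: real
        using that by linarith
      ultimately have "3 * (9 - y) - y * (4 * (4 - y)) + y\<^sup>2 * (7 - 3 * y) > 0" by blast
      then show "w0 > 0" using y unfolding w0_def by simp
      have "4 * (4 - y) - 2 * y * (7 - 3 * y) = 6 * (y - 3/2)\<^sup>2 + 5/2"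
        by (simp add: power2_eq_square algebra_simps)
      also have "\<dots> > 0" by (simp add: add_nonneg_pos)
      finally show "w1 > 0" using y unfolding w1_def by simp
      show "w2 > 0" using y unfolding w2_def by (intro mult_pos_pos) auto
    qed
    have nn: "0 \<le> w0 * q0 + (w1 * q1 + w2 * q2)" "0 \<le> w1 * q1 + w2 * q2" "0 \<le> w2 * q2"
      using w qs by auto
    note r0 = nonneg_combination_eq_0[OF e _ b0 nn(1), simplified]
    note r1 = nonneg_combination_eq_0[OF r0(2) w(1) qs(1) nn(2)]
    note r2 = nonneg_combination_eq_0[OF r1(2) w(2) qs(2) nn(3)]
    have "q2 = 0" using r2(2) w by simp
    then have "b 0 = 0" "b 1 = 0" "b 2 = 0" "b 3 = 0"
      using r0(1) r1(1) r2(1) by (auto simp: q0_def q1_def q2_def)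
    moreover have "\<sigma> = 0 \<or> \<sigma> = 1 \<or> \<sigma> = 2 \<or> \<sigma> = 3" using \<open>\<sigma> < s\<close> 4 by linarith
    ultimately show ?thesis by auto
  qed
qed

text \<open>For \<open>y > 1\<close> the weights \<open>e c \<sigma>\<close> are nonnegative while
  the total is negative. For \<open>s \<le> 2\<close> this is absurd because all
  \<open>b \<sigma>\<close> are nonnegative; for larger \<open>s\<close> an intermediate
  \<open>b \<sigma>\<close> may be negative, and the interpolation lemmas take over.\<close>

lemma moments_imp_y_le_1:
  fixes b :: "nat \<Rightarrow> real" and x y :: real
  assumes s: "1 \<le> s" "s \<le> 4" and y: "x = 1 + y"
    and N0: "(\<Sum>\<sigma>\<le>s. b \<sigma> * y ^ \<sigma>) = 1"
    and N1: "x * (\<Sum>\<sigma>\<le>s. real \<sigma> * (b \<sigma> * y ^ \<sigma>)) = 2 * real s"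
    and N2: "x\<^sup>2 * (\<Sum>\<sigma>\<le>s. real \<sigma> ^ 2 * (b \<sigma> * y ^ \<sigma>)) = 4 * real s ^ 2 - 2 * real s * (x - 2)"
    and b0: "0 \<le> b 0" and q: "\<And>m::nat. 0 \<le> (\<Sum>\<sigma>\<in>{1..s}. b \<sigma> * real (m choose (\<sigma> - 1)))"
  shows "y \<le> 1"
proof (rule ccontr)
  assume "\<not> y \<le> 1"
  define z where "z = y - 1"
  have z: "z > 0" "y = z + 1" "x = z + 2" using \<open>\<not> y \<le> 1\<close> y by (auto simp: z_def)
  \<comment> \<open>\<open>c = 2s\<close> gives the exact identity; a smaller \<open>c\<close> leaves slack, so that weak positivity below suffices.\<close>
  define e where "e = (\<lambda>c \<sigma>::nat. (\<sigma> * x - 2 * real s)\<^sup>2 + c * z :: real)"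
  have high: "(\<Sum>\<sigma>\<le>s. b \<sigma> * y ^ \<sigma> * e c \<sigma>) < 0" if "c < 2 * real s" for c
  proof -
    have "(\<Sum>\<sigma>\<le>s. b \<sigma> * y ^ \<sigma> * e c \<sigma>) = (c - 2 * real s) * z"
      using high_moment_identity[OF N0 N1 N2, of c] by (simp add: z e_def)
    also have "\<dots> < 0" using that z by (simp add: mult_neg_pos)
    finally show ?thesis .
  qed
  have e_nonneg: "0 \<le> e c \<sigma>" if "c \<ge> 0" for c \<sigma> using that z by (simp add: e_def)
  from s consider "s = 1" | "s = 2" | "s = 3" | "s = 4" by linarith
  then show False
  proof cases
    case 1
    note q' = q[unfolded 1 binomial_sum_eq_falling]
    have "0 \<le> b 0 * e 0 0 + b 1 * y * e 0 1"
      using b0 q' z e_nonneg by (intro add_nonneg_nonneg mult_nonneg_nonneg) auto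
    then show False using high[of 0] unfolding 1 sum_atMost_up_to_4 by simp
  next
    case 2
    note q' = q[unfolded 2 binomial_sum_eq_falling]
    have "0 \<le> b 2"
    proof (rule ccontr)
      assume "\<not> 0 \<le> b 2"
      then obtain m :: nat where "b 1 < real m * (- b 2)" using reals_Archimedean3[of "- b 2"] by auto
      then show False using q'[of m] by (simp add: algebra_simps)
    qed
    then have "0 \<le> b 0 * e 0 0 + b 1 * y * e 0 1 + b 2 * y\<^sup>2 * e 0 2"
      using b0 q'[of 0] z e_nonneg by (intro add_nonneg_nonneg mult_nonneg_nonneg) auto
    then show False using high[of 0] unfolding 2 sum_atMost_up_to_4 by simp
  next
    case 3
    note q' = q[unfolded 3 binomial_sum_eq_falling]
    define e1 e2 e3 where "e1 = e 5 1" and "e2 = e 5 2" and "e3 = e 5 3"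
    note E = e1_def e2_def e3_def
    have ez: "e1 = z\<^sup>2 - 3 * z + 16" "e2 = 4 * z\<^sup>2 - 3 * z + 4" "e3 = 9 * z\<^sup>2 + 5 * z"
      by (simp_all add: E e_def 3 z power2_eq_square algebra_simps)
    have "e1 = (z - 3/2)\<^sup>2 + 55/4" by (simp add: ez power2_eq_square algebra_simps)
    then have e1: "e1 > 0" by (simp add: add_nonneg_pos)
    have "0 \<le> b 1 * (y * e1) + b 2 * (y\<^sup>2 * e2) + b 3 * (y ^ 3 * e3)"
    proof (rule quadratic_functional_nonneg[OF q'])
      show "y * e1 > 0" using e1 z by simp
      show "y\<^sup>2 * e2 \<ge> 0" using e_nonneg by (simp add: E)
      fix i :: nat
      have "0 \<le> e1 * (real i)\<^sup>2 + (e1 - 2 * y * e2) * i + 2 * y\<^sup>2 * e3"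
      \<comment> \<open>The discriminant of this quadratic in \<open>i\<close> is \<open>64\<close>
        at \<open>z = 0\<close>, so it cannot settle small \<open>z\<close>; there all coefficients
        are nonnegative instead.\<close>
      proof (cases "z \<le> 1/4")
        case True
        have "z\<^sup>2 \<le> 1/4 * (1/4)" unfolding power2_eq_square using True z by (intro mult_mono) auto
        moreover have "z ^ 3 \<le> z\<^sup>2 * (1/4)" using True z by (simp add: power3_eq_cube power2_eq_square)
        moreover have "e1 - 2 * y * e2 = 8 - 5 * z - z\<^sup>2 - 8 * z ^ 3"
          by (simp add: ez z(2) power2_eq_square power3_eq_cube algebra_simps)
        ultimately have "e1 - 2 * y * e2 \<ge> 0" using True by linarith
        then show ?thesis using e1 e_nonneg[of 5 3] by (simp add: E)
      next
        case False
        have "(e1 - 2 * y * e2)\<^sup>2 - 4 * e1 * (2 * y\<^sup>2 * e3)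
            = 64 - 720 * z - 2303 * z ^ 2 - 2646 * z ^ 3 - 671 * z ^ 4 + 48 * z ^ 5 - 8 * z ^ 6"
          by (simp add: ez z(2) power2_eq_square eval_nat_numeral algebra_simps)
        \<comment> \<open>The square absorbs \<open>48 * z ^ 5\<close>, the only positive term
          besides the constant.\<close>
        also have "\<dots> = (64 - 720 * z) - 2303 * z ^ 2 - 2646 * z ^ 3 - 599 * z ^ 4 - 8 * z ^ 4 * (z - 3)\<^sup>2"
          by (simp add: power2_eq_square eval_nat_numeral algebra_simps)
        also have "\<dots> \<le> 0"
        proof -
          have "0 \<le> z ^ 2" "0 \<le> z ^ 3" "0 \<le> z ^ 4" "0 \<le> z ^ 4 * (z - 3)\<^sup>2" using z by auto
          then show ?thesis using False by linarith
        qed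
        finally show ?thesis by (intro quadratic_form_nonneg e1) simp
      qed
      then have "0 \<le> y * (e1 * (real i)\<^sup>2 + (e1 - 2 * y * e2) * i + 2 * y\<^sup>2 * e3)"
        using z by simp
      then show "0 \<le> 2 * (y ^ 3 * e3) - 2 * i * (y\<^sup>2 * e2) + real i * (real i + 1) * (y * e1)"
        by (simp add: power2_eq_square power3_eq_cube algebra_simps)
    qed
    moreover have "0 \<le> b 0 * e 5 0" using b0 e_nonneg by simp
    ultimately show False using high[of 5] unfolding 3 sum_atMost_up_to_4 E by (simp add: mult.assoc)
  next
    case 4
    note q' = q[unfolded 4 binomial_sum_eq_falling]
    define e1 e2 e3 e4 where "e1 = e 7 1" and "e2 = e 7 2" and "e3 = e 7 3" and "e4 = e 7 4"
    note E = e1_def e2_def e3_def e4_def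
    have ez: "e1 = z\<^sup>2 - 5 * z + 36" "e2 = 4 * z\<^sup>2 - 9 * z + 16" "e3 = 9 * z\<^sup>2 - 5 * z + 4" "e4 = 16 * z\<^sup>2 + 7 * z"
      by (simp_all add: E e_def 4 z power2_eq_square algebra_simps)
    have "e1 = (z - 5/2)\<^sup>2 + 119/4" "e2 = 4 * (z - 9/8)\<^sup>2 + 175/16"
      by (simp_all add: ez power2_eq_square algebra_simps)
    then have e1: "e1 > 0" and e2: "e2 > 0" by (simp_all add: add_nonneg_pos)
    have pz: "0 \<le> z ^ 2" "0 \<le> z ^ 3" "0 \<le> z ^ 4" "0 \<le> z ^ 4 * (z - 5)\<^sup>2" using z by auto
    have "0 \<le> b 1 * (y * e1) + b 2 * (y\<^sup>2 * e2) + b 3 * (y ^ 3 * e3) + b 4 * (y ^ 4 * e4)"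
    proof (rule cubic_functional_nonneg[OF q'])
      show "y\<^sup>2 * e2 > 0" using e2 z by simp
      show "y ^ 3 * e3 \<ge> 0" using e_nonneg z by (simp add: E)
      fix i :: nat
      have "(e1 - 2 * y * e2)\<^sup>2 - 4 * e1 * (2 * y\<^sup>2 * e3)
          = -1136 - 856 * z - 327 * z ^ 2 - 4130 * z ^ 3 - 1671 * z ^ 4 + 80 * z ^ 5 - 8 * z ^ 6"
        by (simp add: ez z(2) power2_eq_square eval_nat_numeral algebra_simps)
      also have "\<dots> = -1136 - 856 * z - 327 * z ^ 2 - 4130 * z ^ 3 - 1471 * z ^ 4 - 8 * (z ^ 4 * (z - 5)\<^sup>2)"
        by (simp add: power2_eq_square eval_nat_numeral algebra_simps)
      also have "\<dots> \<le> 0" using pz z by linarith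
      finally have "0 \<le> e1 * (real i)\<^sup>2 + (e1 - 2 * y * e2) * i + 2 * y\<^sup>2 * e3"
        by (intro quadratic_form_nonneg e1) simp
      then have "0 \<le> y * (e1 * (real i)\<^sup>2 + (e1 - 2 * y * e2) * i + 2 * y\<^sup>2 * e3)"
        using z by simp
      then show "0 \<le> 2 * (y ^ 3 * e3) - 2 * i * (y\<^sup>2 * e2) + real i * (real i + 1) * (y * e1)"
        by (simp add: power2_eq_square power3_eq_cube algebra_simps)
      \<comment> \<open>Discriminant of the condition for \<open>m (m - i) (m - i - 1)\<close>, read
        as a quadratic in \<open>i\<close>.\<close>
      have "(- (e2 + 4 * y * e3))\<^sup>2 - 4 * e2 * (6 * y\<^sup>2 * e4 + 4 * y * e3)
          = - 2688 * z - 9983 * z ^ 2 - 9048 * z ^ 3 - 96 * z ^ 4 + 576 * z ^ 5 - 240 * z ^ 6"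
        by (simp add: ez z(2) power2_eq_square eval_nat_numeral algebra_simps)
      also have "\<dots> \<le> 0"
      \<comment> \<open>Only \<open>576 * z ^ 5\<close> is positive: the cubic term dominates it up
        to \<open>z = 3\<close>, the sixth power beyond.\<close>
      proof (cases "z \<le> 3")
        case True
        then have "z\<^sup>2 \<le> 3\<^sup>2" using z by (intro power_mono) auto
        then have "z ^ 3 * z\<^sup>2 \<le> z ^ 3 * 3\<^sup>2" using z by (intro mult_left_mono) auto
        then have "z ^ 5 \<le> 9 * z ^ 3" by (simp add: power_add[symmetric])
        moreover have "0 \<le> z ^ 6" using z by simp
        ultimately show ?thesis using pz z by linarith
      next
        case False
        then have "z ^ 5 * 3 \<le> z ^ 5 * z" using z by (intro mult_left_mono) auto
        then have "3 * z ^ 5 \<le> z ^ 6" by (simp add: power_Suc2[symmetric])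
        moreover have "0 \<le> z ^ 5" using z by simp
        ultimately show ?thesis using pz z by linarith
      qed
      finally have "0 \<le> e2 * (real i)\<^sup>2 + (- (e2 + 4 * y * e3)) * i + (6 * y\<^sup>2 * e4 + 4 * y * e3)"
        by (intro quadratic_form_nonneg e2) (simp only: diff_le_0_iff_le)
      then have "0 \<le> y\<^sup>2 * (e2 * (real i)\<^sup>2 + (- (e2 + 4 * y * e3)) * i + (6 * y\<^sup>2 * e4 + 4 * y * e3))"
        using z by simp
      then show "0 \<le> 6 * (y ^ 4 * e4) - 4 * (real i - 1) * (y ^ 3 * e3) + real i * (real i - 1) * (y\<^sup>2 * e2)"
        by (simp add: power2_eq_square eval_nat_numeral algebra_simps)
    qed
    moreover have "0 \<le> b 0 * e 7 0" using b0 e_nonneg by simp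
    ultimately show False using high[of 7] unfolding 4 sum_atMost_up_to_4 E by (simp add: mult.assoc)
  qed
qed

section \<open>Partial fractions and order conditions\<close>

text \<open>Vandermonde's identity. It identifies \<open>q(m)\<close> with the derivative of order
  \<open>Suc m\<close>, up to positive factors.\<close>

lemma sum_binomial_pochhammer:
  fixes d :: "nat \<Rightarrow> real"
  shows "(\<Sum>\<sigma>\<in>{1..s}. (\<Sum>j\<le>s. real (j choose \<sigma>) * d j) * real (m choose (\<sigma> - 1)))
       = (\<Sum>j\<le>s. d j * pochhammer (real j) (Suc m)) / fact (Suc m)"
proof -
  have "(\<Sum>\<sigma>\<in>{1..s}. real (j choose \<sigma>) * real (m choose (\<sigma> - 1))) = pochhammer (real j) (Suc m) / fact (Suc m)"
    if "j \<le> s" for j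
  proof -
    \<comment> \<open>The extra index \<open>0\<close> contributes nothing, since
      \<open>m choose Suc m = 0\<close>; all other indices outside the common range also give zero
      binomials.\<close>
    have "(\<Sum>\<sigma>\<in>{1..s}. (j choose \<sigma>) * (m choose (\<sigma> - 1))) = (\<Sum>k\<le>Suc m. (j choose k) * (m choose (Suc m - k)))"
    proof (rule sum.mono_neutral_cong)
      show "(j choose i) * (m choose (Suc m - i)) = 0" if "i \<in> {..Suc m} - {1..s}" for i
        using that \<open>j \<le> s\<close> by (cases "i = 0") (auto simp: binomial_eq_0)
      show "(j choose i) * (m choose (i - 1)) = 0" if "i \<in> {1..s} - {..Suc m}" for i
        using that by (auto simp: binomial_eq_0)
      show "(j choose i) * (m choose (i - 1)) = (j choose i) * (m choose (Suc m - i))"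
        if "i \<in> {1..s} \<inter> {..Suc m}" for i
      proof -
        have "m - (i - 1) = Suc m - i" "i - 1 \<le> m" using that by auto
        then show ?thesis using binomial_symmetric[of "i - 1" m] by simp
      qed
    qed auto
    also have "\<dots> = (j + m) choose Suc m" by (rule vandermonde)
    finally have "(\<Sum>\<sigma>\<in>{1..s}. real (j choose \<sigma>) * real (m choose (\<sigma> - 1))) = real ((j + m) choose Suc m)"
      by (metis (mono_tags, lifting) of_nat_mult of_nat_sum sum.cong)
    also have "\<dots> = pochhammer (real j) (Suc m) / fact (Suc m)"
      by (simp add: binomial_gbinomial gbinomial_pochhammer')
    finally show ?thesis .
  qed
  then have "(\<Sum>j\<le>s. d j * (\<Sum>\<sigma>\<in>{1..s}. real (j choose \<sigma>) * real (m choose (\<sigma> - 1))))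
       = (\<Sum>j\<le>s. d j * (pochhammer (real j) (Suc m) / fact (Suc m)))"
    by (intro sum.cong) auto
  moreover have "(\<Sum>\<sigma>\<in>{1..s}. (\<Sum>j\<le>s. real (j choose \<sigma>) * d j) * real (m choose (\<sigma> - 1)))
      = (\<Sum>j\<le>s. d j * (\<Sum>\<sigma>\<in>{1..s}. real (j choose \<sigma>) * real (m choose (\<sigma> - 1))))"
    unfolding sum_distrib_left sum_distrib_right by (subst sum.swap) (simp add: mult_ac)
  ultimately show ?thesis by (simp add: sum_divide_distrib)
qed

text \<open>The \<open>b \<sigma>\<close> are the coefficients of \<open>\<Sum> d j * t ^ j\<close>
  re-expanded in powers of \<open>v = t - 1\<close>.\<close>

lemma sum_binomial_power:
  fixes d :: "nat \<Rightarrow> real"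
  shows "(\<Sum>\<sigma>\<le>s. (\<Sum>j\<le>s. real (j choose \<sigma>) * d j) * v ^ \<sigma>) = (\<Sum>j\<le>s. d j * (1 + v) ^ j)"
proof -
  have "(\<Sum>\<sigma>\<le>s. real (j choose \<sigma>) * v ^ \<sigma>) = (1 + v) ^ j" if "j \<le> s" for j
  proof -
    have "(1 + v) ^ j = (v + 1) ^ j" by (simp add: add.commute)
    also have "\<dots> = (\<Sum>\<sigma>\<le>j. real (j choose \<sigma>) * v ^ \<sigma>)" by (simp add: binomial_ring)
    also have "\<dots> = (\<Sum>\<sigma>\<le>s. real (j choose \<sigma>) * v ^ \<sigma>)"
      using that by (intro sum.mono_neutral_left) (auto simp: binomial_eq_0)
    finally show ?thesis ..
  qed
  then have "(\<Sum>j\<le>s. d j * (\<Sum>\<sigma>\<le>s. real (j choose \<sigma>) * v ^ \<sigma>)) = (\<Sum>j\<le>s. d j * (1 + v) ^ j)"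
    by (intro sum.cong) auto
  moreover have "(\<Sum>\<sigma>\<le>s. (\<Sum>j\<le>s. real (j choose \<sigma>) * d j) * v ^ \<sigma>) = (\<Sum>j\<le>s. d j * (\<Sum>\<sigma>\<le>s. real (j choose \<sigma>) * v ^ \<sigma>))"
    unfolding sum_distrib_left sum_distrib_right by (subst sum.swap) (simp add: mult_ac)
  ultimately show ?thesis by simp
qed

text \<open>These are the first and second derivatives of the re-expansion at
  \<open>t = 1 + y\<close>, rewritten with the Euler operators in \<open>t\<close> and
  \<open>y\<close>.\<close>

lemma sum_binomial_power_moments:
  fixes d :: "nat \<Rightarrow> real"
  assumes "1 \<le> s" "s \<le> 4"
  defines "b \<equiv> \<lambda>\<sigma>. \<Sum>j\<le>s. real (j choose \<sigma>) * d j"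
  shows "(1 + y) * (\<Sum>\<sigma>\<le>s. real \<sigma> * (b \<sigma> * y ^ \<sigma>)) = y * (\<Sum>j\<le>s. real j * (d j * (1 + y) ^ j))"
    and "(1 + y)\<^sup>2 * (\<Sum>\<sigma>\<le>s. real \<sigma> ^ 2 * (b \<sigma> * y ^ \<sigma>)) =
       y\<^sup>2 * (\<Sum>j\<le>s. real j * (real j + 1) * (d j * (1 + y) ^ j)) + (1 - y) * (y * (\<Sum>j\<le>s. real j * (d j * (1 + y) ^ j)))"
proof -
  have C: "(3::nat) choose 2 = 3" "(4::nat) choose 2 = 6" "(4::nat) choose 3 = 4"
    by (simp_all add: eval_nat_numeral)
  from assms consider "s = 1" | "s = 2" | "s = 3" | "s = 4" by linarith
  note cs = this
  show "(1 + y) * (\<Sum>\<sigma>\<le>s. real \<sigma> * (b \<sigma> * y ^ \<sigma>)) = y * (\<Sum>j\<le>s. real j * (d j * (1 + y) ^ j))"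
    by (cases rule: cs; hypsubst; unfold b_def sum_atMost_up_to_4; simp add: C; simp add: eval_nat_numeral algebra_simps)
  show "(1 + y)\<^sup>2 * (\<Sum>\<sigma>\<le>s. real \<sigma> ^ 2 * (b \<sigma> * y ^ \<sigma>)) =
       y\<^sup>2 * (\<Sum>j\<le>s. real j * (real j + 1) * (d j * (1 + y) ^ j)) + (1 - y) * (y * (\<Sum>j\<le>s. real j * (d j * (1 + y) ^ j)))"
    by (cases rule: cs; hypsubst; unfold b_def sum_atMost_up_to_4; simp add: C; simp add: eval_nat_numeral algebra_simps)
qed

text \<open>The \<open>d j\<close> are partial-fraction coefficients scaled so that
  \<open>t = 1\<close> corresponds to the point \<open>-2s\<close> and \<open>t = x\<close> to the
  point \<open>0\<close>: order conditions live at \<open>x\<close>, nonnegativity at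
  \<open>1\<close>.\<close>

lemma partial_fractions_determined:
  fixes d :: "nat \<Rightarrow> real"
  assumes s: "1 \<le> s" "s \<le> 4" and a: "a > 0" and x: "x = 1 + 2 * real s * a"
    and D0: "(\<Sum>j\<le>s. d j * x ^ j) = 1"
    and D1: "a * (\<Sum>j\<le>s. real j * (d j * x ^ j)) = 1"
    and D2: "a\<^sup>2 * (\<Sum>j\<le>s. real j * (real j + 1) * (d j * x ^ j)) = 1"
    and nonneg: "\<And>k. 0 \<le> (\<Sum>j\<le>s. d j * pochhammer (real j) k)"
  shows "a = 1 / (2 * real s)" and "(\<Sum>j\<le>s. d j * t ^ j) = (t - 1) ^ s"
proof -
  define b where "b = (\<lambda>\<sigma>. \<Sum>j\<le>s. real (j choose \<sigma>) * d j)"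
  define y where "y = 2 * real s * a"
  have y: "y > 0" "x = 1 + y" using s a x by (auto simp: y_def)
  have B: "(\<Sum>\<sigma>\<le>s. b \<sigma> * v ^ \<sigma>) = (\<Sum>j\<le>s. d j * (1 + v) ^ j)" for v
    unfolding b_def by (rule sum_binomial_power)
  have y1: "y * (\<Sum>j\<le>s. real j * (d j * x ^ j)) = 2 * real s"
    using D1 by (simp add: y_def)
  have "y\<^sup>2 * (\<Sum>j\<le>s. real j * (real j + 1) * (d j * x ^ j))
      = 4 * real s ^ 2 * (a\<^sup>2 * (\<Sum>j\<le>s. real j * (real j + 1) * (d j * x ^ j)))"
    by (simp add: y_def power_mult_distrib)
  then have y2: "y\<^sup>2 * (\<Sum>j\<le>s. real j * (real j + 1) * (d j * x ^ j)) = 4 * real s ^ 2"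
    unfolding D2 by simp
  have N0: "(\<Sum>\<sigma>\<le>s. b \<sigma> * y ^ \<sigma>) = 1" using B[of y] D0 y by simp
  have N1: "x * (\<Sum>\<sigma>\<le>s. real \<sigma> * (b \<sigma> * y ^ \<sigma>)) = 2 * real s"
    using sum_binomial_power_moments(1)[OF s, of y d] y1 by (simp add: y b_def)
  have N2: "x\<^sup>2 * (\<Sum>\<sigma>\<le>s. real \<sigma> ^ 2 * (b \<sigma> * y ^ \<sigma>)) = 4 * real s ^ 2 - 2 * real s * (x - 2)"
  proof -
    have "x\<^sup>2 * (\<Sum>\<sigma>\<le>s. real \<sigma> ^ 2 * (b \<sigma> * y ^ \<sigma>)) = 4 * real s ^ 2 + (1 - y) * (2 * real s)"
      using sum_binomial_power_moments(2)[OF s, of y d] unfolding y(2)[symmetric] y1 y2 b_def .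
    then show ?thesis by (simp add: y(2) algebra_simps)
  qed
  have b0: "0 \<le> b 0" using nonneg[of 0] by (simp add: b_def)
  have q: "0 \<le> (\<Sum>\<sigma>\<in>{1..s}. b \<sigma> * real (m choose (\<sigma> - 1)))" for m
    unfolding b_def sum_binomial_pochhammer using nonneg[of "Suc m"] by simp
  have "y \<le> 1" by (rule moments_imp_y_le_1[OF s y(2) N0 N1 N2 b0 q])
  then have zero: "b \<sigma> = 0" if "\<sigma> < s" for \<sigma>
    using coeffs_vanish_below_top[OF s y(1) _ y(2) N0 N1 N2 b0 q that] by blast
  have top: "(\<Sum>\<sigma>\<le>s. f \<sigma> * (b \<sigma> * v ^ \<sigma>)) = f s * (b s * v ^ s)" for v and f :: "nat \<Rightarrow> real"
    using zero by (subst sum.remove[of _ s]) (auto intro!: sum.neutral)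
  have 1: "b s * y ^ s = 1" using N0 top[of "\<lambda>_. 1" y] by simp
  \<comment> \<open>With one coefficient left, total mass 1 reduces the mean condition to
    \<open>x * s = 2 * s\<close>.\<close>
  then have "x = 2" using N1 s unfolding top by simp
  then have "y = 1" using y by simp
  then show "a = 1 / (2 * real s)" using s by (simp add: y_def field_simps)
  have "b s = 1" using 1 \<open>y = 1\<close> by simp
  then show "(\<Sum>j\<le>s. d j * t ^ j) = (t - 1) ^ s"
    using B[of "t - 1"] top[of "\<lambda>_. 1" "t - 1"] by simp
qed

section \<open>Derivatives and existence of partial fractions\<close>

lemma higher_deriv_partial_fractions:
  fixes c :: "nat \<Rightarrow> real"
  assumes f: "\<And>z. 1 - a * z \<noteq> 0 \<Longrightarrow> f z = (\<Sum>j\<le>n. c j * inverse (1 - a * z) ^ j)"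
    and "1 - a * z \<noteq> 0"
  shows "(deriv ^^ k) f z = a ^ k * (\<Sum>j\<le>n. c j * pochhammer (real j) k * inverse (1 - a * z) ^ (j + k))"
    and "((deriv ^^ k) f has_real_derivative (deriv ^^ Suc k) f z) (at z)"
proof -
  let ?D = "\<lambda>k z. a ^ k * (\<Sum>j\<le>n. c j * pochhammer (real j) k * inverse (1 - a * z) ^ (j + k))"
  have D: "(?D k has_real_derivative ?D (Suc k) z) (at z)" if "1 - a * z \<noteq> 0" for k z
  proof -
    have pw: "((\<lambda>z. inverse (1 - a * z) ^ m) has_real_derivative (real m * a * inverse (1 - a * z) ^ Suc m)) (at z)" for m
    proof (cases m)
      case (Suc l)
      have "((\<lambda>z. inverse (1 - a * z)) has_real_derivative a * inverse (1 - a * z) ^ 2) (at z)"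
        using that by (auto intro!: derivative_eq_intros simp: power2_eq_square)
      from DERIV_cong[OF DERIV_power_Suc[OF this, of l]] show ?thesis
        using Suc by (simp add: power2_eq_square mult_ac)
    qed simp
    show ?thesis
      by (rule derivative_eq_intros pw | simp add: sum_distrib_left pochhammer_Suc mult_ac)+
  qed
  have opn: "open {z. 1 - a * z \<noteq> 0}" by (intro open_Collect_neq continuous_intros)
  have eq: "(deriv ^^ k) f z = ?D k z" if "1 - a * z \<noteq> 0" for k z
    using that
  proof (induction k arbitrary: z)
    case 0
    then show ?case by (simp add: f)
  next
    case (Suc k)
    have "eventually (\<lambda>w. (deriv ^^ k) f w = ?D k w) (nhds z)"
      using eventually_nhds_in_open[OF opn, of z] Suc by (auto elim!: eventually_mono)
    then have "deriv ((deriv ^^ k) f) z = deriv (?D k) z" by (rule deriv_cong_ev) simp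
    then show ?case using DERIV_imp_deriv[OF D[OF Suc.prems, of k]] by simp
  qed
  show "(deriv ^^ k) f z = ?D k z" by (rule eq) fact
  have "eventually (\<lambda>w. (deriv ^^ k) f w = ?D k w) (nhds z)"
    using eventually_nhds_in_open[OF opn, of z] assms(2) eq by (auto elim!: eventually_mono)
  then show "((deriv ^^ k) f has_real_derivative (deriv ^^ Suc k) f z) (at z)"
    using D[OF assms(2), of k] eq[OF assms(2), of "Suc k"] by (subst DERIV_cong_ev) auto
qed

text \<open>Expand \<open>P\<close> in powers of \<open>u = 1 - a * z\<close>, that is, substitute
  \<open>z = (1 - u) / a\<close>; dividing by \<open>u ^ s\<close> then reverses the
  coefficients.\<close>

lemma partial_fractions_exist:
  fixes P :: "real poly"
  assumes "degree P \<le> s" "a \<noteq> 0"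
  obtains c where "\<And>z. 1 - a * z \<noteq> 0 \<Longrightarrow>
    poly P z / poly ([:1, -a:] ^ s) z = (\<Sum>j\<le>s. c j * inverse (1 - a * z) ^ j)"
proof -
  define R where "R = pcompose P [:1 / a, - 1 / a:]"
  have deg: "degree R \<le> s"
    using degree_pcompose_le[of P "[:1 / a, - 1 / a:]"] assms by (simp add: R_def)
  have "poly P z / poly ([:1, -a:] ^ s) z = (\<Sum>j\<le>s. coeff R (s - j) * inverse (1 - a * z) ^ j)"
    if z: "1 - a * z \<noteq> 0" for z
  proof -
    have "poly P z = poly R (1 - a * z)" using assms(2) by (simp add: R_def poly_pcompose field_simps)
    also have "\<dots> = (\<Sum>i\<le>s. coeff R i * (1 - a * z) ^ i)"
      unfolding poly_altdef using deg
      by (intro sum.mono_neutral_left) (auto simp: coeff_eq_0)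
    also have "\<dots> = (\<Sum>j\<le>s. coeff R (s - j) * (1 - a * z) ^ (s - j))"
      by (rule sum.nat_diff_reindex[of "\<lambda>i. coeff R i * (1 - a * z) ^ i" "Suc s", symmetric, unfolded lessThan_Suc_atMost diff_Suc_Suc])
    finally have "poly P z / poly ([:1, -a:] ^ s) z = (\<Sum>j\<le>s. coeff R (s - j) * (1 - a * z) ^ (s - j) / (1 - a * z) ^ s)"
      by (simp add: poly_power sum_divide_distrib mult.commute)
    also have "\<dots> = (\<Sum>j\<le>s. coeff R (s - j) * inverse (1 - a * z) ^ j)"
      using z by (intro sum.cong refl) (simp add: power_diff power_inverse divide_simps)
    finally show ?thesis .
  qed
  then show thesis by (rule that)
qed

lemma rfun_eq_divide:
  assumes "poly Q z \<noteq> 0"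
  shows "\<not> is_pole P Q z" and "rfun P Q z = poly P z / poly Q z"
proof -
  define g where "g = gcd P Q"
  have "P = rnum P Q * g" "Q = rden P Q * g" by (simp_all add: rnum_def rden_def g_def)
  then have *: "poly P z = poly (rnum P Q) z * poly g z" "poly Q z = poly (rden P Q) z * poly g z"
    by (metis poly_mult)+
  with assms show "\<not> is_pole P Q z" "rfun P Q z = poly P z / poly Q z"
    by (auto simp: is_pole_def rfun_def)
qed

section \<open>Order two as three Taylor conditions\<close>

lemma taylor_bigo:
  fixes D :: "nat \<Rightarrow> real \<Rightarrow> real"
  assumes "e > 0"
    and D: "\<And>m t. m < n \<Longrightarrow> \<bar>t\<bar> \<le> e \<Longrightarrow> (D m has_real_derivative D (Suc m) t) (at t)"
    and cont: "continuous_on {-e..e} (D n)"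
  shows "(\<lambda>z. D 0 z - (\<Sum>m<n. D m 0 / fact m * z ^ m)) \<in> O[at 0](\<lambda>z. z ^ n)"
proof -
  have "bounded (D n ` {-e..e})"
    using compact_continuous_image[OF cont] by (simp add: compact_imp_bounded)
  then obtain B where "\<forall>x\<in>D n ` {-e..e}. norm x \<le> B"
    unfolding bounded_iff by blast
  then have B: "\<bar>D n t\<bar> \<le> B" if "\<bar>t\<bar> \<le> e" for t using that by (simp add: abs_le_iff)
  have "eventually (\<lambda>z. z \<in> {-e<..<e}) (nhds (0::real))"
    using \<open>e > 0\<close> by (intro eventually_nhds_in_open) auto
  then have "eventually (\<lambda>z. \<bar>z\<bar> \<le> e) (at (0::real))"
    by (auto simp: eventually_at_filter elim!: eventually_mono)
  then have "eventually (\<lambda>z. norm (D 0 z - (\<Sum>m<n. D m 0 / fact m * z ^ m)) \<le> B / fact n * norm (z ^ n)) (at 0)"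
  proof eventually_elim
    case (elim z)
    then obtain t where t: "\<bar>t\<bar> \<le> \<bar>z\<bar>"
      "D 0 z = (\<Sum>m<n. D m 0 / fact m * z ^ m) + D n t / fact n * z ^ n"
      using Maclaurin_bi_le[of D "D 0" n z] D by fastforce
    have "\<bar>D n t\<bar> \<le> B" using t elim B by simp
    then have "\<bar>D n t\<bar> / fact n * \<bar>z ^ n\<bar> \<le> B / fact n * \<bar>z ^ n\<bar>"
      by (intro mult_right_mono divide_right_mono) auto
    then show ?case using t by (simp add: abs_mult)
  qed
  then show ?thesis by (rule bigoI)
qed

text \<open>The quotient by \<open>z ^ 2\<close> tends to 0; multiplying it by \<open>z ^ 2\<close>,
  by \<open>z\<close> and by 1 isolates the three coefficients in turn.\<close>

lemma quadratic_in_bigo_cube_iff: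
  fixes c0 c1 c2 :: real
  shows "(\<lambda>z. c0 + c1 * z + c2 * z\<^sup>2) \<in> O[at 0](\<lambda>z. z ^ 3) \<longleftrightarrow> c0 = 0 \<and> c1 = 0 \<and> c2 = 0"
proof
  let ?f = "\<lambda>z. c0 + c1 * z + c2 * z\<^sup>2"
  assume "?f \<in> O[at 0](\<lambda>z. z ^ 3)"
  moreover have "(\<lambda>z::real. z ^ 3) \<in> o[at 0](\<lambda>z. z ^ 2)" by real_asymp
  ultimately have "?f \<in> o[at 0](\<lambda>z. z ^ 2)" by (rule landau_o.big_small_trans)
  then have l: "((\<lambda>z. ?f z / z ^ 2) \<longlongrightarrow> 0) (at 0)" by (rule smalloD_tendsto)
  have c0: "c0 = 0"
  proof -
    have "((\<lambda>z. ?f z / z ^ 2 * z ^ 2) \<longlongrightarrow> 0) (at 0)"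
      using tendsto_mult[OF l tendsto_power[OF tendsto_ident_at, of 2]] by (simp only: mult_zero_left)
    then have "(?f \<longlongrightarrow> 0) (at 0)"
      by (rule Lim_transform_eventually) (auto simp: eventually_at_filter)
    moreover have "(?f \<longlongrightarrow> c0 + c1 * 0 + c2 * 0\<^sup>2) (at 0)" by (intro tendsto_intros)
    ultimately show ?thesis using tendsto_unique[OF at_neq_bot] by fastforce
  qed
  have c1: "c1 = 0"
  proof -
    have "((\<lambda>z. ?f z / z ^ 2 * z) \<longlongrightarrow> 0) (at 0)"
      using tendsto_mult[OF l tendsto_ident_at] by (simp only: mult_zero_left)
    then have "((\<lambda>z. c1 + c2 * z) \<longlongrightarrow> 0) (at 0)"
      by (rule Lim_transform_eventually) (auto simp: eventually_at_filter c0 field_simps power2_eq_square)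
    moreover have "((\<lambda>z. c1 + c2 * z) \<longlongrightarrow> c1 + c2 * 0) (at 0)" by (intro tendsto_intros)
    ultimately show ?thesis using tendsto_unique[OF at_neq_bot] by fastforce
  qed
  have "((\<lambda>z. c2) \<longlongrightarrow> 0) (at (0::real))"
    using l by (rule Lim_transform_eventually) (auto simp: eventually_at_filter c0 c1)
  then have "c2 = 0" by (simp add: tendsto_const_iff)
  with c0 c1 show "c0 = 0 \<and> c1 = 0 \<and> c2 = 0" by simp
next
  assume "c0 = 0 \<and> c1 = 0 \<and> c2 = 0"
  then show "(\<lambda>z. c0 + c1 * z + c2 * z\<^sup>2) \<in> O[at 0](\<lambda>z. z ^ 3)" by simp
qed

lemma order_two_iff:
  fixes F :: "nat \<Rightarrow> real \<Rightarrow> real"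
  assumes "e > 0"
    and F: "\<And>m t. m < 4 \<Longrightarrow> \<bar>t\<bar> \<le> e \<Longrightarrow> (F m has_real_derivative F (Suc m) t) (at t)"
  shows "(\<lambda>z. F 0 z - exp z) \<in> O[at 0](\<lambda>z. z ^ 3) \<longleftrightarrow> F 0 0 = 1 \<and> F 1 0 = 1 \<and> F 2 0 = 1"
proof -
  define D where "D = (\<lambda>m z. F m z - exp z)"
  define T where "T = (\<lambda>z::real. (F 0 0 - 1) + (F 1 0 - 1) * z + (F 2 0 - 1) / 2 * z\<^sup>2)"
  have D: "(D m has_real_derivative D (Suc m) t) (at t)" if "m < 4" "\<bar>t\<bar> \<le> e" for m t
    unfolding D_def by (intro derivative_intros F that DERIV_exp)
  \<comment> \<open>The remainder bound needs the third derivative to be continuous; this is why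
    differentiability is assumed up to \<open>m = 3\<close>.\<close>
  have "continuous_on {-e..e} (D 3)"
    by (intro continuous_at_imp_continuous_on ballI DERIV_isCont[OF D]) (auto simp: abs_le_iff)
  then have "(\<lambda>z. D 0 z - (\<Sum>m<3. D m 0 / fact m * z ^ m)) \<in> O[at 0](\<lambda>z. z ^ 3)"
    using D by (intro taylor_bigo[OF \<open>e > 0\<close>]) auto
  also have "(\<lambda>z. D 0 z - (\<Sum>m<3. D m 0 / fact m * z ^ m)) = (\<lambda>z. (F 0 z - exp z) - T z)"
    by (simp add: D_def T_def eval_nat_numeral)
  finally have R: "(\<lambda>z. (F 0 z - exp z) - T z) \<in> O[at 0](\<lambda>z. z ^ 3)" .
  have "(\<lambda>z. F 0 z - exp z) \<in> O[at 0](\<lambda>z. z ^ 3) \<longleftrightarrow> T \<in> O[at 0](\<lambda>z. z ^ 3)"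
  proof
    assume "(\<lambda>z. F 0 z - exp z) \<in> O[at 0](\<lambda>z. z ^ 3)"
    from sum_in_bigo(2)[OF this R] show "T \<in> O[at 0](\<lambda>z. z ^ 3)" by simp
  next
    assume "T \<in> O[at 0](\<lambda>z. z ^ 3)"
    from sum_in_bigo(1)[OF R this] show "(\<lambda>z. F 0 z - exp z) \<in> O[at 0](\<lambda>z. z ^ 3)" by simp
  qed
  also have "\<dots> \<longleftrightarrow> F 0 0 = 1 \<and> F 1 0 = 1 \<and> F 2 0 = 1"
    unfolding T_def quadratic_in_bigo_cube_iff by simp
  finally show ?thesis .
qed

lemma order_two_partial_fractions_iff:
  assumes f: "\<And>z. 1 - a * z \<noteq> 0 \<Longrightarrow> f z = (\<Sum>j\<le>n. c j * inverse (1 - a * z) ^ j)"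
  shows "(\<lambda>z. f z - exp z) \<in> O[at 0](\<lambda>z. z ^ 3) \<longleftrightarrow>
    (\<Sum>j\<le>n. c j) = 1 \<and> a * (\<Sum>j\<le>n. real j * c j) = 1 \<and> a\<^sup>2 * (\<Sum>j\<le>n. real j * (real j + 1) * c j) = 1"
proof -
  \<comment> \<open>Keeps \<open>\<bar>a * t\<bar> \<le> 1/2\<close>, away from the pole; the
    \<open>+ 1\<close> covers \<open>a = 0\<close>.\<close>
  define e where "e = 1 / (2 * (\<bar>a\<bar> + 1))"
  have "e > 0" by (simp add: e_def add_nonneg_pos)
  have nz: "1 - a * t \<noteq> 0" if "\<bar>t\<bar> \<le> e" for t
  proof -
    have "\<bar>a * t\<bar> \<le> (\<bar>a\<bar> + 1) * e" using that unfolding abs_mult by (intro mult_mono) auto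
    also have "\<dots> = 1 / 2" by (simp add: e_def field_simps add_nonneg_eq_0_iff)
    finally show ?thesis by auto
  qed
  note hd = higher_deriv_partial_fractions[of a f c n, OF f]
  have "(\<lambda>z. (deriv ^^ 0) f z - exp z) \<in> O[at 0](\<lambda>z. z ^ 3) \<longleftrightarrow>
      (deriv ^^ 0) f 0 = 1 \<and> (deriv ^^ 1) f 0 = 1 \<and> (deriv ^^ 2) f 0 = 1"
    by (rule order_two_iff[OF \<open>e > 0\<close>]) (rule hd(2), use nz in auto)
  moreover have "pochhammer r 2 = r * (r + 1)" for r :: real
    by (simp add: eval_nat_numeral pochhammer_Suc)
  ultimately show ?thesis
    by (subst (asm) (1 2 3) hd(1)) (simp_all add: mult_ac)
qed

section \<open>Excluding \<open>a \<le> 0\<close>\<close>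

text \<open>The Euler operator multiplies the coefficient of \<open>t ^ k\<close> by
  \<open>k\<close>, and \<open>k \<le> s\<close>.\<close>

lemma nonneg_coeffs_euler_bound:
  fixes G :: "real poly"
  assumes "degree G \<le> s" "\<And>k. 0 \<le> coeff G k" "0 \<le> t"
  shows "t * poly (pderiv G) t \<le> s * poly G t"
proof -
  define H where "H = smult (real s) G - [:0, 1:] * pderiv G"
  have "coeff H k = (real s - k) * coeff G k" for k
    by (cases k) (simp_all add: H_def coeff_pderiv algebra_simps)
  then have "0 \<le> coeff H k" for k
    using assms(1,2) by (cases "k \<le> s") (auto simp: coeff_eq_0)
  then have "0 \<le> poly H t" unfolding poly_altdef using assms(3) by (intro sum_nonneg) auto
  then show ?thesis by (simp add: H_def)
qed

lemma higher_deriv_poly: "(deriv ^^ k) (poly p) = poly ((pderiv ^^ k) p)"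
  for p :: "real poly"
proof (induction k)
  case (Suc k)
  have "deriv (poly q) = poly (pderiv q)" for q :: "real poly"
    by (rule ext, rule DERIV_imp_deriv, rule poly_DERIV)
  then show ?case using Suc by simp
qed simp

lemma higher_pderiv_eq_coeff_shift:
  fixes p :: "real poly"
  shows "poly ((pderiv ^^ k) p) x = fact k * coeff (pcompose p [:x, 1:]) k"
proof -
  have "(pderiv ^^ k) (pcompose p [:x, 1:]) = pcompose ((pderiv ^^ k) p) [:x, 1:]"
    by (induction k) (simp_all add: pderiv_pcompose pderiv_pCons)
  then have "coeff ((pderiv ^^ k) (pcompose p [:x, 1:])) 0 = poly ((pderiv ^^ k) p) x"
    by (simp add: poly_0_coeff_0[symmetric] poly_pcompose)
  then show ?thesis by (simp add: coeff_higher_pderiv pochhammer_fact)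
qed

text \<open>Re-expanded at \<open>x\<close>, \<open>P\<close> has nonnegative coefficients, so the
  Euler bound at the origin compares \<open>P(0)\<close> with \<open>P'(0)\<close>. Both are 1,
  hence \<open>- x \<le> s\<close>.\<close>

lemma polynomial_case_impossible:
  fixes P :: "real poly"
  assumes "degree P \<le> s" "s \<ge> 1" and order: "(\<lambda>z. poly P z - exp z) \<in> O[at 0](\<lambda>z. z ^ 3)"
    and x: "x < - real s" and am: "\<And>k. 0 \<le> (deriv ^^ k) (poly P) x"
  shows False
proof -
  have "(\<lambda>z. poly ((pderiv ^^ 0) P) z - exp z) \<in> O[at 0](\<lambda>z. z ^ 3) \<longleftrightarrow>
     poly ((pderiv ^^ 0) P) 0 = 1 \<and> poly ((pderiv ^^ 1) P) 0 = 1 \<and> poly ((pderiv ^^ 2) P) 0 = 1"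
    by (rule order_two_iff[of 1 "\<lambda>k. poly ((pderiv ^^ k) P)"]) (auto intro: poly_DERIV)
  then have P: "poly P 0 = 1" "poly (pderiv P) 0 = 1" using order by simp_all
  define G where "G = pcompose P [:x, 1:]"
  have "degree G \<le> s" using degree_pcompose_le[of P "[:x, 1:]"] assms(1) by (simp add: G_def)
  moreover have "0 \<le> coeff G k" for k
  proof -
    have "0 \<le> fact k * coeff G k"
      using am[of k] by (simp add: higher_deriv_poly higher_pderiv_eq_coeff_shift G_def)
    then show ?thesis using mult_le_cancel_left_pos[of "fact k" 0 "coeff G k"] by simp
  qed
  ultimately have "(-x) * poly (pderiv G) (-x) \<le> s * poly G (-x)"
    using x by (intro nonneg_coeffs_euler_bound) auto
  then have "- x \<le> s" using P by (simp add: G_def poly_pcompose pderiv_pcompose pderiv_pCons)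
  then show False using x by simp
qed

text \<open>\<open>q\<close> has degree at most 3, so its fourth difference vanishes; the
  alternating signs make all its terms nonpositive. Hence \<open>q 0 = 0\<close>, but
  \<open>a * q 0 = 1\<close> by the first order condition.\<close>

lemma alternating_case_impossible:
  fixes c :: "nat \<Rightarrow> real"
  assumes s: "1 \<le> s" "s \<le> 4" and "a < 0"
    and nonneg: "\<And>k. 0 \<le> a ^ k * (\<Sum>j\<le>s. c j * pochhammer (real j) k)"
    and order: "a * (\<Sum>j\<le>s. real j * c j) = 1"
  shows False
proof -
  define b where "b = (\<lambda>\<sigma>. \<Sum>j\<le>s. real (j choose \<sigma>) * c j)"
  define q where "q = (\<lambda>m::nat. \<Sum>\<sigma>\<in>{1..s}. b \<sigma> * real (m choose (\<sigma> - 1)))"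
  have q: "0 \<le> a ^ Suc m * q m" for m
  proof -
    have "a ^ Suc m * q m = a ^ Suc m * (\<Sum>j\<le>s. c j * pochhammer (real j) (Suc m)) / fact (Suc m)"
      unfolding q_def b_def sum_binomial_pochhammer by simp
    also have "\<dots> \<ge> 0" using nonneg[of "Suc m"] by (intro divide_nonneg_pos) auto
    finally show ?thesis .
  qed
  have "q 4 - 4 * q 3 + 6 * q 2 - 4 * q 1 + q 0 = 0"
  proof -
    from s consider "s = 1" | "s = 2" | "s = 3" | "s = 4" by linarith
    then show ?thesis
      by cases (simp_all only: q_def binomial_sum_eq_falling, simp_all add: algebra_simps)
  qed
  moreover have "q m \<le> 0" if "even m" for m
  proof -
    have "a ^ Suc m < 0" using that \<open>a < 0\<close> unfolding power_less_zero_eq by simp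
    then show ?thesis using q[of m] by (metis mult_neg_pos not_le)
  qed
  moreover have "0 \<le> q m" if "odd m" for m
  proof -
    have "0 < a ^ Suc m" using that \<open>a < 0\<close> unfolding zero_less_power_eq by simp
    then show ?thesis using q[of m] by (metis mult_pos_neg not_le)
  qed
  ultimately have "q 4 - 4 * q 3 + 6 * q 2 - 4 * q 1 + q 0 = 0"
    "q 0 \<le> 0" "0 \<le> q 1" "q 2 \<le> 0" "0 \<le> q 3" "q 4 \<le> 0"
    by simp_all
  moreover have "q 0 \<noteq> 0"
  proof -
    have "q 0 = (\<Sum>j\<le>s. real j * c j)"
      unfolding q_def b_def sum_binomial_pochhammer by (simp add: mult_ac)
    then show ?thesis using order by auto
  qed
  ultimately show False by linarith
qed

section \<open>The extremal function\<close>

lemma poly_linear_power: "poly ([:1, b:] ^ n) z = (1 + b * z) ^ n" for b z :: real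
  by (simp add: poly_power mult.commute)

text \<open>The endpoint \<open>-2s\<close> is left out of the hypothesis because a supremum equal
  to \<open>2s\<close> says nothing there directly.\<close>

lemma order_two_maximal_unique:
  assumes s: "1 \<le> s" "s \<le> 4" and P: "in_hatPi s s 2 P a"
    and am: "\<And>x. - (2 * real s) < x \<Longrightarrow> x \<le> 0 \<Longrightarrow> abs_monotonic_at P ([:1, -a:] ^ s) x"
  shows "a = 1 / (2 * real s)" and "P = [:1, 1 / (2 * real s):] ^ s"
proof -
  let ?Q = "[:1, -a:] ^ s"
  have deg: "degree P \<le> s" and order: "(\<lambda>z. poly P z / poly ?Q z - exp z) \<in> O[at 0](\<lambda>z. z ^ 3)"
    using P by (simp_all add: in_hatPi_def in_Pi_def)
  have "a \<noteq> 0"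
  proof
    assume "a = 0"
    then have Q: "poly ?Q z = 1" for z by (simp add: poly_linear_power)
    then have "rfun P ?Q = poly P" by (intro ext) (simp add: rfun_eq_divide)
    \<comment> \<open>Any point strictly between \<open>-2s\<close> and \<open>-s\<close> would
      serve.\<close>
    moreover have "abs_monotonic_at P ?Q (- (3 / 2 * real s))" using s by (intro am) auto
    ultimately have "0 \<le> (deriv ^^ k) (poly P) (- (3 / 2 * real s))" for k
      by (simp add: abs_monotonic_at_def)
    moreover have "(\<lambda>z. poly P z - exp z) \<in> O[at 0](\<lambda>z. z ^ 3)" using order by (simp only: Q div_by_1)
    ultimately show False
      using polynomial_case_impossible[OF deg s(1), of "- (3 / 2 * real s)"] s by simp
  qed
  then obtain c where c: "\<And>z. 1 - a * z \<noteq> 0 \<Longrightarrow> poly P z / poly ?Q z = (\<Sum>j\<le>s. c j * inverse (1 - a * z) ^ j)"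
    using partial_fractions_exist[OF deg] by metis
  have rf: "rfun P ?Q z = (\<Sum>j\<le>s. c j * inverse (1 - a * z) ^ j)" if "1 - a * z \<noteq> 0" for z
  proof -
    have "poly ?Q z \<noteq> 0" using that unfolding poly_linear_power by simp
    then show ?thesis by (rule trans[OF rfun_eq_divide(2) c[OF that]])
  qed
  have am': "0 \<le> a ^ k * (\<Sum>j\<le>s. c j * pochhammer (real j) k * inverse (1 - a * x) ^ (j + k))"
    if "- (2 * real s) < x" "x \<le> 0" "1 - a * x \<noteq> 0" for k x
    using am[OF that(1,2)] higher_deriv_partial_fractions(1)[of a "rfun P ?Q", OF rf that(3)]
    by (simp add: abs_monotonic_at_def)
  have c0: "(\<Sum>j\<le>s. c j) = 1" and c1: "a * (\<Sum>j\<le>s. real j * c j) = 1"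
    and c2: "a\<^sup>2 * (\<Sum>j\<le>s. real j * (real j + 1) * c j) = 1"
    using order_two_partial_fractions_iff[of a "\<lambda>z. poly P z / poly ?Q z", OF c] order by auto
  have "a > 0"
  proof (rule ccontr)
    assume "\<not> a > 0"
    with \<open>a \<noteq> 0\<close> have "a < 0" by simp
    have "0 \<le> a ^ k * (\<Sum>j\<le>s. c j * pochhammer (real j) k)" for k
      using am'[of 0 k] s by simp
    then show False by (rule alternating_case_impossible[OF s \<open>a < 0\<close> _ c1])
  qed
  define x where "x = 1 + 2 * real s * a"
  have "x > 0" using s \<open>a > 0\<close> by (simp add: x_def add_pos_nonneg)
  \<comment> \<open>\<open>x\<close> is the value of \<open>1 - a * z\<close> at
    \<open>z = -2s\<close>, so this scaling moves that point to \<open>t = 1\<close>.\<close>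
  define d where "d = (\<lambda>j. c j * inverse x ^ j)"
  have d: "d j * (x * t) ^ j = c j * t ^ j" for j t
    using \<open>x > 0\<close> by (simp add: d_def power_mult_distrib power_inverse)
  have nonneg: "0 \<le> (\<Sum>j\<le>s. d j * pochhammer (real j) k)" for k
  proof -
    \<comment> \<open>The derivative of order \<open>k\<close> without its positive factor
      \<open>a ^ k * inverse (1 - a * v) ^ k\<close>. Its sign is known only to the right of
      \<open>-2s\<close>, and continuity carries it to the endpoint.\<close>
    let ?g = "\<lambda>v. \<Sum>j\<le>s. c j * inverse (1 - a * v) ^ j * pochhammer (real j) k"
    have "1 - a * (- (2 * real s)) \<noteq> 0" using \<open>x > 0\<close> by (simp add: x_def mult_ac)
    then have "(?g \<longlongrightarrow> ?g (- (2 * real s))) (at_right (- (2 * real s)))"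
      by (intro tendsto_intros)
    moreover have "eventually (\<lambda>v. 0 \<le> ?g v) (at_right (- (2 * real s)))"
    proof -
      have "0 \<le> ?g v" if v: "- (2 * real s) < v" "v < 0" for v
      proof -
        have "a * v < 0" using v \<open>a > 0\<close> by (simp add: mult_pos_neg)
        then have w: "1 - a * v > 0" by simp
        have "a ^ k * inverse (1 - a * v) ^ k * ?g v
            = a ^ k * (\<Sum>j\<le>s. c j * pochhammer (real j) k * inverse (1 - a * v) ^ (j + k))"
          by (simp add: sum_distrib_left power_add mult_ac)
        also have "\<dots> \<ge> 0" using v w by (intro am') auto
        finally show ?thesis
          using \<open>a > 0\<close> w mult_le_cancel_left_pos[of "a ^ k * inverse (1 - a * v) ^ k" 0 "?g v"] by simp
      qed
      then show ?thesis using s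
        by (auto simp: eventually_at_right[of _ 0] intro!: exI[of _ 0])
    qed
    ultimately have "0 \<le> ?g (- (2 * real s))"
      by (rule tendsto_lowerbound) simp
    then show ?thesis by (simp add: d_def x_def mult_ac)
  qed
  have d1: "d j * x ^ j = c j" for j using d[of j 1] by simp
  have D: "(\<Sum>j\<le>s. d j * x ^ j) = 1" "a * (\<Sum>j\<le>s. real j * (d j * x ^ j)) = 1"
    "a\<^sup>2 * (\<Sum>j\<le>s. real j * (real j + 1) * (d j * x ^ j)) = 1"
    unfolding d1 by (fact c0 c1 c2)+
  note det = partial_fractions_determined[OF s \<open>a > 0\<close> x_def D nonneg]
  show a: "a = 1 / (2 * real s)" by (rule det(1))
  have "x = 2" using s by (simp add: x_def a)
  \<comment> \<open>Agreement on a half-line free of poles is enough to identify the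
    polynomials.\<close>
  have "poly P z = poly ([:1, a:] ^ s) z" if "z \<le> 0" for z
  proof -
    have "a * z \<le> 0" using that \<open>a > 0\<close> by (simp add: mult_nonneg_nonpos)
    then have w: "1 - a * z > 0" by simp
    have "poly P z / poly ?Q z = (\<Sum>j\<le>s. d j * (2 * inverse (1 - a * z)) ^ j)"
      using c[of z] w unfolding d[unfolded \<open>x = 2\<close>] by simp
    also have "\<dots> = (2 * inverse (1 - a * z) - 1) ^ s" by (rule det(2))
    also have "2 * inverse (1 - a * z) - 1 = (1 + a * z) / (1 - a * z)" using w by (simp add: field_simps)
    finally show ?thesis using w unfolding poly_linear_power by (simp add: power_divide)
  qed
  then have "{..0} \<subseteq> {z. poly (P - [:1, a:] ^ s) z = 0}" by auto
  moreover have "infinite {..0::real}" by (rule infinite_Iic)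
  ultimately have "P - [:1, a:] ^ s = 0" using poly_roots_finite finite_subset by metis
  then show "P = [:1, 1 / (2 * real s):] ^ s" by (simp add: a)
qed

section \<open>Derivatives and radius of the extremal function\<close>

text \<open>Both sides are \<open>w ^ \<sigma> / fact \<sigma>\<close> times the
  \<open>\<sigma>\<close>-th derivative of \<open>(2 * w - 1) ^ s\<close> in
  \<open>w\<close>.\<close>

lemma extremal_binomial_sum:
  fixes w :: real
  assumes "\<sigma> \<le> s"
  shows "(\<Sum>j\<le>s. real (j choose \<sigma>) * (real (s choose j) * 2 ^ j * (-1) ^ (s - j) * w ^ j))
    = real (s choose \<sigma>) * (2 * w) ^ \<sigma> * (2 * w - 1) ^ (s - \<sigma>)"
proof -
  have "(\<Sum>j\<le>s. real (j choose \<sigma>) * (real (s choose j) * 2 ^ j * (-1) ^ (s - j) * w ^ j))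
      = (\<Sum>j=\<sigma>..s. real (s choose j) * real (j choose \<sigma>) * ((2 * w) ^ j * (-1) ^ (s - j)))"
    by (rule sum.mono_neutral_cong_right) (auto simp: binomial_eq_0 power_mult_distrib)
  also have "\<dots> = (\<Sum>j=\<sigma>..s. real (s choose \<sigma>) * real ((s - \<sigma>) choose (j - \<sigma>)) * ((2 * w) ^ j * (-1) ^ (s - j)))"
    by (intro sum.cong refl) (simp add: choose_mult flip: of_nat_mult)
  also have "\<dots> = (\<Sum>i\<le>s - \<sigma>. real (s choose \<sigma>) * real ((s - \<sigma>) choose i) * ((2 * w) ^ (i + \<sigma>) * (-1) ^ (s - \<sigma> - i)))"
    by (rule sum.reindex_bij_witness[of _ "\<lambda>i. i + \<sigma>" "\<lambda>j. j - \<sigma>"]) (use assms in \<open>auto\<close>)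
  also have "\<dots> = real (s choose \<sigma>) * (2 * w) ^ \<sigma> * (\<Sum>i\<le>s - \<sigma>. real ((s - \<sigma>) choose i) * (2 * w) ^ i * (-1) ^ (s - \<sigma> - i))"
    by (simp add: sum_distrib_left power_add mult_ac)
  also have "\<dots> = real (s choose \<sigma>) * (2 * w) ^ \<sigma> * (2 * w + (-1)) ^ (s - \<sigma>)"
    by (simp only: binomial_ring)
  finally show ?thesis by simp
qed

text \<open>With \<open>w = inverse (1 - a * z)\<close>, the base of the power is
  \<open>2 * w - 1\<close>. The reduced form serves absolute monotonicity, the plain quotient the
  order condition.\<close>

lemma extremal_partial_fractions:
  fixes a z :: real
  assumes "1 - a * z \<noteq> 0"
  shows "rfun ([:1, a:] ^ s) ([:1, -a:] ^ s) z
     = (\<Sum>j\<le>s. (real (s choose j) * 2 ^ j * (-1) ^ (s - j)) * inverse (1 - a * z) ^ j)"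
    and "poly ([:1, a:] ^ s) z / poly ([:1, -a:] ^ s) z
     = (\<Sum>j\<le>s. (real (s choose j) * 2 ^ j * (-1) ^ (s - j)) * inverse (1 - a * z) ^ j)"
proof -
  have Q: "poly ([:1, -a:] ^ s) z \<noteq> 0" using assms unfolding poly_linear_power by simp
  have "(1 + a * z) / (1 - a * z) = 2 * inverse (1 - a * z) - 1" using assms by (simp add: field_simps)
  then have "poly ([:1, a:] ^ s) z / poly ([:1, -a:] ^ s) z = (2 * inverse (1 - a * z) - 1) ^ s"
    unfolding poly_linear_power by (simp flip: power_divide)
  also have "\<dots> = (\<Sum>j\<le>s. (real (s choose j) * 2 ^ j * (-1) ^ (s - j)) * inverse (1 - a * z) ^ j)"
    using extremal_binomial_sum[of 0 s "inverse (1 - a * z)"] by simp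
  finally show *: "poly ([:1, a:] ^ s) z / poly ([:1, -a:] ^ s) z
     = (\<Sum>j\<le>s. (real (s choose j) * 2 ^ j * (-1) ^ (s - j)) * inverse (1 - a * z) ^ j)" .
  show "rfun ([:1, a:] ^ s) ([:1, -a:] ^ s) z
     = (\<Sum>j\<le>s. (real (s choose j) * 2 ^ j * (-1) ^ (s - j)) * inverse (1 - a * z) ^ j)"
    using * rfun_eq_divide(2)[OF Q] by simp
qed

text \<open>In this form, for \<open>a > 0\<close>, every term is visibly nonnegative as long as
  \<open>w \<ge> 1/2\<close>, that is, from \<open>z = - 1 / a\<close> up to the pole.\<close>

lemma extremal_higher_deriv:
  fixes a z :: real
  assumes "1 - a * z \<noteq> 0"
  defines "w \<equiv> inverse (1 - a * z)"
  shows "(deriv ^^ 0) (rfun ([:1, a:] ^ s) ([:1, -a:] ^ s)) z = (2 * w - 1) ^ s"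
    and "(deriv ^^ Suc m) (rfun ([:1, a:] ^ s) ([:1, -a:] ^ s)) z = (a * w) ^ Suc m * fact (Suc m) *
      (\<Sum>\<sigma>\<in>{1..s}. real (s choose \<sigma>) * (2 * w) ^ \<sigma> * (2 * w - 1) ^ (s - \<sigma>) * real (m choose (\<sigma> - 1)))"
proof -
  let ?c = "\<lambda>j. real (s choose j) * 2 ^ j * (-1) ^ (s - j)"
  show "(deriv ^^ 0) (rfun ([:1, a:] ^ s) ([:1, -a:] ^ s)) z = (2 * w - 1) ^ s"
    using extremal_partial_fractions(1)[OF assms(1), of s] extremal_binomial_sum[of 0 s w] by (simp add: w_def)
  have "(deriv ^^ Suc m) (rfun ([:1, a:] ^ s) ([:1, -a:] ^ s)) z
      = a ^ Suc m * (\<Sum>j\<le>s. ?c j * pochhammer (real j) (Suc m) * w ^ (j + Suc m))"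
    unfolding w_def
    by (rule higher_deriv_partial_fractions(1)[of a, OF extremal_partial_fractions(1) assms(1)])
  also have "\<dots> = (a * w) ^ Suc m * (\<Sum>j\<le>s. (?c j * w ^ j) * pochhammer (real j) (Suc m))"
    by (simp only: power_add power_mult_distrib sum_distrib_left mult_ac)
  also have "(\<Sum>j\<le>s. (?c j * w ^ j) * pochhammer (real j) (Suc m)) = fact (Suc m) *
      (\<Sum>\<sigma>\<in>{1..s}. (\<Sum>j\<le>s. real (j choose \<sigma>) * (?c j * w ^ j)) * real (m choose (\<sigma> - 1)))"
    unfolding sum_binomial_pochhammer by simp
  also have "(\<Sum>\<sigma>\<in>{1..s}. (\<Sum>j\<le>s. real (j choose \<sigma>) * (?c j * w ^ j)) * real (m choose (\<sigma> - 1)))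
      = (\<Sum>\<sigma>\<in>{1..s}. real (s choose \<sigma>) * (2 * w) ^ \<sigma> * (2 * w - 1) ^ (s - \<sigma>) * real (m choose (\<sigma> - 1)))"
    by (intro sum.cong refl) (simp only: extremal_binomial_sum atLeastAtMost_iff)
  finally show "(deriv ^^ Suc m) (rfun ([:1, a:] ^ s) ([:1, -a:] ^ s)) z = (a * w) ^ Suc m * fact (Suc m) *
      (\<Sum>\<sigma>\<in>{1..s}. real (s choose \<sigma>) * (2 * w) ^ \<sigma> * (2 * w - 1) ^ (s - \<sigma>) * real (m choose (\<sigma> - 1)))"
    by (simp only: mult.assoc)
qed

lemma extremal_in_hatPi:
  assumes "1 \<le> s" "s \<le> 4"
  shows "in_hatPi s s 2 ([:1, 1 / (2 * real s):] ^ s) (1 / (2 * real s))"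
proof -
  let ?a = "1 / (2 * real s)" and ?c = "\<lambda>j. real (s choose j) * 2 ^ j * (-1) ^ (s - j)"
  have C: "(3::nat) choose 2 = 3" "(4::nat) choose 2 = 6" "(4::nat) choose 3 = 4"
    by (simp_all add: eval_nat_numeral)
  from assms consider "s = 1" | "s = 2" | "s = 3" | "s = 4" by linarith
  then have "(\<Sum>j\<le>s. ?c j) = 1 \<and> ?a * (\<Sum>j\<le>s. real j * ?c j) = 1 \<and> ?a\<^sup>2 * (\<Sum>j\<le>s. real j * (real j + 1) * ?c j) = 1"
    by cases (simp_all only: sum_atMost_up_to_4, simp_all add: C power2_eq_square)
  then have "(\<lambda>z. poly ([:1, ?a:] ^ s) z / poly ([:1, - ?a:] ^ s) z - exp z) \<in> O[at 0](\<lambda>z. z ^ 3)"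
    using order_two_partial_fractions_iff[of ?a, OF extremal_partial_fractions(2)[of ?a]] by blast
  moreover have "degree ([:1, b:] ^ s) \<le> s" for b :: real
    using degree_power_le[of "[:1, b:]" s] by (simp split: if_splits)
  ultimately show ?thesis by (simp add: in_hatPi_def in_Pi_def)
qed

lemma extremal_radius:
  assumes s: "1 \<le> s"
  shows "radius_am ([:1, 1 / (2 * real s):] ^ s) ([:1, -(1 / (2 * real s)):] ^ s) = ereal (2 * real s)"
proof -
  define a where "a = 1 / (2 * real s)"
  let ?P = "[:1, a:] ^ s" and ?Q = "[:1, -a:] ^ s"
  let ?R = "{r. r \<ge> 0 \<and> (\<forall>x\<in>{-r..0}. abs_monotonic_at ?P ?Q x)} \<union> {0}"
  have "a > 0" using s by (simp add: a_def)
  have pos: "1 - a * x > 0" if "x \<le> 0" for x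
  proof -
    have "a * x \<le> 0" using that \<open>a > 0\<close> by (simp add: mult_nonneg_nonpos)
    then show ?thesis by simp
  qed
  have "2 * real s \<in> ?R"
  proof -
    have "abs_monotonic_at ?P ?Q x" if x: "- (2 * real s) \<le> x" "x \<le> 0" for x
    proof -
      define w where "w = inverse (1 - a * x)"
      have "a * (- x) \<le> a * (2 * real s)" using x \<open>a > 0\<close> by (intro mult_left_mono) auto
      also have "\<dots> = 1" using s by (simp add: a_def)
      finally have "1 - a * x \<le> 2" by simp
      then have w: "0 < w" "0 \<le> 2 * w - 1" using pos[OF x(2)] by (simp_all add: w_def field_simps)
      have nz: "1 - a * x \<noteq> 0" using pos[OF x(2)] by simp
      have "0 \<le> (deriv ^^ k) (rfun ?P ?Q) x" for k
      proof (cases k)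
        case 0
        show ?thesis unfolding 0 extremal_higher_deriv(1)[OF nz] using w by (simp add: w_def)
      next
        case (Suc m)
        show ?thesis unfolding Suc extremal_higher_deriv(2)[OF nz] w_def[symmetric]
          using w \<open>a > 0\<close> by (intro mult_nonneg_nonneg sum_nonneg zero_le_power) auto
      qed
      moreover have "\<not> is_pole ?P ?Q x" using nz by (intro rfun_eq_divide, unfold poly_linear_power) simp
      ultimately show ?thesis by (simp add: abs_monotonic_at_def)
    qed
    then show ?thesis by simp
  qed
  moreover have "r \<le> 2 * real s" if "r \<in> ?R" for r
  proof (rule ccontr)
    assume r: "\<not> r \<le> 2 * real s"
    then have "r \<noteq> 0" by auto
    with that have "abs_monotonic_at ?P ?Q (- r)" by auto
    then have am: "0 \<le> (deriv ^^ k) (rfun ?P ?Q) (- r)" for k by (simp add: abs_monotonic_at_def)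
    have nz: "1 - a * (- r) \<noteq> 0" using pos[of "- r"] r by auto
    define w where "w = inverse (1 - a * (- r))"
    have "1 - a * (- r) > 2" using r s by (simp add: a_def field_simps)
    then have w: "0 < w" "2 * w - 1 < 0" by (simp_all add: w_def field_simps)
    show False
    \<comment> \<open>Left of \<open>-2s\<close> the base \<open>2 * w - 1\<close> is negative. For
      odd \<open>s\<close> the function itself is negative; for even \<open>s\<close> its first
      derivative is, where only \<open>\<sigma> = 1\<close> survives.\<close>
    proof (cases "odd s")
      case True
      then have "(2 * w - 1) ^ s < 0" using w by (simp add: power_less_zero_eq)
      then show False using am[of 0] unfolding extremal_higher_deriv(1)[OF nz] w_def[symmetric] by linarith
    next
      case False
      have "(\<Sum>\<sigma>\<in>{1..s}. real (s choose \<sigma>) * (2 * w) ^ \<sigma> * (2 * w - 1) ^ (s - \<sigma>) * real (0 choose (\<sigma> - 1)))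
          = (\<Sum>\<sigma>\<in>{1}. real (s choose \<sigma>) * (2 * w) ^ \<sigma> * (2 * w - 1) ^ (s - \<sigma>) * real (0 choose (\<sigma> - 1)))"
        using s by (intro sum.mono_neutral_right) (auto simp: binomial_eq_0)
      then have "0 \<le> a * w * (real s * (2 * w) * (2 * w - 1) ^ (s - 1))"
        using am[of "Suc 0"] unfolding extremal_higher_deriv(2)[OF nz] w_def[symmetric] by simp
      moreover have "(2 * w - 1) ^ (s - 1) < 0" using False s w by (simp add: power_less_zero_eq)
      then have "a * w * (real s * (2 * w) * (2 * w - 1) ^ (s - 1)) < 0"
        using w s \<open>a > 0\<close> by (intro mult_pos_neg mult_pos_pos) auto
      ultimately show False by simp
    qed
  qed
  ultimately have "Sup (ereal ` ?R) = ereal (2 * real s)"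
    by (intro antisym Sup_least Sup_upper) auto
  then show ?thesis by (simp add: radius_am_def a_def)
qed

section \<open>From the radius to the theorem\<close>

text \<open>Strictness allows for a supremum that is not attained; it also forces
  \<open>r > 0\<close>, so the adjoined \<open>0\<close> is harmless.\<close>

lemma abs_monotonic_inside_radius:
  assumes "ereal (- x) < radius_am P Q" "x \<le> 0"
  shows "abs_monotonic_at P Q x"
proof -
  obtain r where "r \<in> {r. r \<ge> 0 \<and> (\<forall>x\<in>{-r..0}. abs_monotonic_at P Q x)} \<union> {0}" "ereal (- x) < ereal r"
    using assms(1) unfolding radius_am_def less_Sup_iff by blast
  with assms(2) show ?thesis by auto
qed

theorem theorem2p2:
  fixes s :: nat
  assumes "1 \<le> s" and "s \<le> 4"
  shows "hatR s s 2 = ereal (2 * real s)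
    \<and> in_hatPi s s 2 ([:1, 1 / (2 * real s):] ^ s) (1 / (2 * real s))
    \<and> radius_am ([:1, 1 / (2 * real s):] ^ s) ([:1, -(1 / (2 * real s)):] ^ s) = ereal (2 * real s)
    \<and> (\<forall>P a. in_hatPi s s 2 P a \<and> radius_am P ([:1, -a:] ^ s) = ereal (2 * real s) \<longrightarrow>
          P * [:1, -(1 / (2 * real s)):] ^ s = [:1, 1 / (2 * real s):] ^ s * [:1, -a:] ^ s)"
proof -
  note s = assms
  \<comment> \<open>Assuming only a lower bound on the radius also gives the upper bound: a larger
    radius would force the extremal function, whose radius is exactly \<open>2s\<close>.\<close>
  have unique: "a = 1 / (2 * real s)" "P = [:1, 1 / (2 * real s):] ^ s"
    if "in_hatPi s s 2 P a" "ereal (2 * real s) \<le> radius_am P ([:1, -a:] ^ s)" for P a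
  proof -
    have am: "abs_monotonic_at P ([:1, -a:] ^ s) x" if "- (2 * real s) < x" "x \<le> 0" for x
    proof (rule abs_monotonic_inside_radius)
      have "ereal (- x) < ereal (2 * real s)" using that by simp
      then show "ereal (- x) < radius_am P ([:1, -a:] ^ s)" using \<open>ereal (2 * real s) \<le> _\<close> by (rule less_le_trans)
    qed (fact that)
    show "a = 1 / (2 * real s)" "P = [:1, 1 / (2 * real s):] ^ s"
      by (rule order_two_maximal_unique[OF s that(1) am]; assumption)+
  qed
  have le: "radius_am P ([:1, -a:] ^ s) \<le> ereal (2 * real s)" if "in_hatPi s s 2 P a" for P a
  proof (rule ccontr)
    assume "\<not> ?thesis"
    then have gt: "ereal (2 * real s) < radius_am P ([:1, -a:] ^ s)" by simp
    note eq = unique[OF that less_imp_le[OF gt]]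
    show False using gt unfolding eq extremal_radius[OF s(1)] by simp
  qed
  have "hatR s s 2 = ereal (2 * real s)"
    unfolding hatR_def
  proof (intro antisym Sup_least Sup_upper)
    show "ereal (2 * real s) \<in> {radius_am P ([:1, -a:] ^ s) |P a. in_hatPi s s 2 P a}"
      using extremal_in_hatPi[OF s] extremal_radius[OF s(1)] by force
  qed (use le in auto)
  moreover have "P * [:1, -(1 / (2 * real s)):] ^ s = [:1, 1 / (2 * real s):] ^ s * [:1, -a:] ^ s"
    if "in_hatPi s s 2 P a" "radius_am P ([:1, -a:] ^ s) = ereal (2 * real s)" for P a
    using unique[of P a] that by (metis order_refl)
  ultimately show ?thesis
    using extremal_in_hatPi[OF s] extremal_radius[OF s(1)] by blast
qed

end
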